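(* Let $k\ge2$ be an integer, let $g_0$ be a $k$-monotone density on $(0,\infty)$ with distribution function $G_0$ satisfying $\int_0^\infty x^{-1/2}\,dG_0(x)<\infty$, let $X_1,X_2,\dots$ be i.i.d. with density $g_0$, and let $\tilde g_n$ be the least squares estimator over $\mathcal M_k\cap L_2(\lambda)$ based on $X_1,\dots,X_n$. Let $c>0$. Then for $j=1,\dots,k-2$, $$\sup_{x\in[c,\infty)}|\tilde g_n^{(j)}(x)-g_0^{(j)}(x)|\to0\quad\text{almost surely as }n\to\infty,$$ and for each $x>0$ at which $g_0$ is $(k-1)$-times differentiable, $$\tilde g_n^{(k-1)}(x)\to g_0^{(k-1)}(x)\quad\text{almost surely as }n\to\infty.$$
   Context: For $k\ge2$, a function $g$ on $(0,\infty)$ is $k$-monotone if $(-1)^l g^{(l)}$ is nonnegative, nonincreasing and convex for $l=0,\dots,k-2$. $\mathcal M_k$ is the class of $k$-monotone functions on $(0,\infty)$; $\lambda$ is Lebesgue measure on $(0,\infty)$. The least squares estimator $\tilde g_n$ is the minimizer over $g\in\mathcal M_k\cap L_2(\lambda)$ of $Q_n(g)=\frac12\int_0^\infty g^2(x)\,dx-\frac1n\sum_{i=1}^n g(X_i)$ (no constraint that $g$ integrates to one is imposed). The estimator is a spline of degree $k-1$, so at its knots $\tilde g_n^{(k-1)}$ is understood as a one-sided derivative (left or right). *)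

theory Defs
  imports "HOL-Probability.Probability"
begin

text \<open>
  Functions on the open half-line are modelled by total functions on the reals of which only
  the values on \<open>{0<..}\<close> matter. The \<open>l\<close>-th derivative is \<open>(deriv ^^ l) g\<close>.
\<close>

text \<open>
  The first clause records that \<open>g\<close> is \<open>(k - 2)\<close>-times differentiable, so that every derivative
  in the second clause is an actual derivative and not a junk value of \<open>deriv\<close>.
\<close>

definition k_monotone :: "nat \<Rightarrow> (real \<Rightarrow> real) \<Rightarrow> bool" where
  "k_monotone k g \<longleftrightarrow>
     (\<forall>l<k - 2. \<forall>x>0. (deriv ^^ l) g differentiable (at x)) \<and>
     (\<forall>l\<le>k - 2.
        (\<forall>x>0. 0 \<le> (-1) ^ l * (deriv ^^ l) g x) \<and>
        antimono_on {0<..} (\<lambda>x. (-1) ^ l * (deriv ^^ l) g x) \<and>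
        convex_on {0<..} (\<lambda>x. (-1) ^ l * (deriv ^^ l) g x))"

definition square_integrable :: "(real \<Rightarrow> real) \<Rightarrow> bool" where
  "square_integrable g \<longleftrightarrow>
     set_borel_measurable lborel {0<..} g \<and> set_integrable lborel {0<..} (\<lambda>x. (g x)\<^sup>2)"

definition halfline_density :: "(real \<Rightarrow> real) \<Rightarrow> real \<Rightarrow> ennreal" where
  "halfline_density g x = ennreal (g x) * indicator {0<..} x"

text \<open>The Lebesgue-Stieltjes measure of the distribution function with density \<open>g\<close>.\<close>

definition law :: "(real \<Rightarrow> real) \<Rightarrow> real measure" where
  "law g = density lborel (halfline_density g)"

definition k_monotone_density :: "nat \<Rightarrow> (real \<Rightarrow> real) \<Rightarrow> bool" where
  "k_monotone_density k g \<longleftrightarrow> k_monotone k g \<and> (\<integral>\<^sup>+x. halfline_density g x \<partial>lborel) = 1"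

definition ls_criterion :: "nat \<Rightarrow> (nat \<Rightarrow> real) \<Rightarrow> (real \<Rightarrow> real) \<Rightarrow> real" where
  "ls_criterion n xs g =
     1 / 2 * (LBINT x:{0<..}. (g x)\<^sup>2) - 1 / real n * (\<Sum>i = 1..n. g (xs i))"

text \<open>
  Minimality is stated as a predicate rather than by choice: the minimizer is determined only
  on \<open>{0<..}\<close>, its values elsewhere being arbitrary.
\<close>

definition is_lse :: "nat \<Rightarrow> nat \<Rightarrow> (nat \<Rightarrow> real) \<Rightarrow> (real \<Rightarrow> real) \<Rightarrow> bool" where
  "is_lse k n xs g \<longleftrightarrow>
     k_monotone k g \<and> square_integrable g \<and>
     (\<forall>h. k_monotone k h \<and> square_integrable h \<longrightarrow>
        ls_criterion n xs g \<le> ls_criterion n xs h)"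

text \<open>
  If \<open>g\<close> is \<open>k\<close>-monotone, \<open>(deriv ^^ (k - 2)) g\<close> is convex up to sign, so its one-sided
  derivatives exist at every positive point.
\<close>

definition right_top_deriv :: "nat \<Rightarrow> (real \<Rightarrow> real) \<Rightarrow> real \<Rightarrow> real" where
  "right_top_deriv k g x = vector_derivative ((deriv ^^ (k - 2)) g) (at_right x)"

definition left_top_deriv :: "nat \<Rightarrow> (real \<Rightarrow> real) \<Rightarrow> real \<Rightarrow> real" where
  "left_top_deriv k g x = vector_derivative ((deriv ^^ (k - 2)) g) (at_left x)"

end

theory Submission
  imports Defs
begin

text \<open>
  The estimator \<open>g\<^sub>n\<close> is shown to converge to \<open>g\<^sub>0\<close> in \<open>L\<^sub>2\<close>, and shape does the rest: for
  monotone functions and a continuous limit, \<open>L\<^sub>2\<close> convergence forces convergence at every point,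
  and for convex functions convergence at every point forces convergence of the one-sided
  derivatives wherever the limit is differentiable.

  For the \<open>L\<^sub>2\<close> step, the criterion is a quadratic minimized over a convex cone, so
  \<open>\<langle>g\<^sub>n, h - g\<^sub>n\<rangle> \<ge> E\<^sub>n h - E\<^sub>n g\<^sub>n\<close> for every competitor \<open>h\<close>, where \<open>E\<^sub>n\<close> is the average over
  the sample (lemma \<open>lse_variational_inequality\<close>). With \<open>h = g\<^sub>0\<close> this bounds the squared error
  by \<open>(E\<^sub>n - E) g\<^sub>n - (E\<^sub>n - E) g\<^sub>0\<close>, where \<open>E\<close> is the expectation under \<open>g\<^sub>0\<close>, so that
  \<open>E g = \<langle>g, g\<^sub>0\<rangle>\<close> (\<open>lse_L2_error_bound\<close>). With \<open>h = 0\<close> it bounds the norm of \<open>g\<^sub>n\<close> by the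
  average of \<open>X\<^sub>i powr (- 1 / 2)\<close>; hence all the \<open>g\<^sub>n\<close> lie below one function
  \<open>C x powr (- 1 / 2)\<close>, and this envelope is integrable under \<open>g\<^sub>0\<close>: this is where the moment
  condition enters, which also makes \<open>g\<^sub>0\<close> square integrable. A monotone function under such an
  envelope is bracketed by step functions on a fixed grid, so \<open>(E\<^sub>n - E) g\<^sub>n\<close> is controlled,
  whatever \<open>g\<^sub>n\<close> is, by finitely many cell frequencies and by the contribution of small
  observations to the same average (\<open>bracketing_bound\<close>). The strong law, applied to countably
  many fixed functions, makes these terms small on one event of probability one
  (\<open>lse_L2_consistent\<close>).

  On that event the derivatives of order \<open>j \<le> k - 2\<close> converge at every point by induction on \<open>j\<close>,
  and the one-sided derivatives of order \<open>k - 1\<close> wherever \<open>g\<^sub>0\<close> has such a derivative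
  (\<open>subgradients_tendsto_derivative\<close>). For \<open>1 \<le> j \<le> k - 2\<close> the derivatives are, up to sign,
  nonnegative and nonincreasing with a continuous limit that vanishes at infinity, so the
  convergence is uniform on \<open>[c, \<infinity>)\<close> (\<open>antimono_pointwise_imp_uniform\<close>).
\<close>

section \<open>A strong law of large numbers for nonnegative functions\<close>

text \<open>
  The cross terms vanish by independence.
\<close>

lemma (in prob_space) second_moment_sum_centered:
  fixes Y :: "'i \<Rightarrow> 'a \<Rightarrow> real"
  assumes fin: "finite I" and ind: "indep_vars (\<lambda>_. borel) Y I"
    and int: "\<And>i. i \<in> I \<Longrightarrow> integrable M (Y i)"
    and int2: "\<And>i. i \<in> I \<Longrightarrow> integrable M (\<lambda>\<omega>. (Y i \<omega>)\<^sup>2)"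
    and mean: "\<And>i. i \<in> I \<Longrightarrow> expectation (Y i) = 0"
  shows "integrable M (\<lambda>\<omega>. (\<Sum>i\<in>I. Y i \<omega>)\<^sup>2)"
    and "expectation (\<lambda>\<omega>. (\<Sum>i\<in>I. Y i \<omega>)\<^sup>2) = (\<Sum>i\<in>I. expectation (\<lambda>\<omega>. (Y i \<omega>)\<^sup>2))"
proof -
  have cross: "integrable M (\<lambda>\<omega>. Y i \<omega> * Y j \<omega>) \<and>
      expectation (\<lambda>\<omega>. Y i \<omega> * Y j \<omega>) = (if i = j then expectation (\<lambda>\<omega>. (Y i \<omega>)\<^sup>2) else 0)"
    if ij: "i \<in> I" "j \<in> I" for i j
  proof (cases "i = j")
    case True
    then show ?thesis using int2[OF ij(1)] by (simp add: power2_eq_square)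
  next
    case False
    have "indep_vars (\<lambda>_. borel) Y {i, j}"
      using ind ij by (auto intro: indep_vars_subset)
    moreover have "integrable M (Y a)" if "a \<in> {i, j}" for a using that ij int by auto
    ultimately show ?thesis
      using indep_vars_lebesgue_integral[of "{i, j}" Y] indep_vars_integrable[of "{i, j}" Y] False ij
      by (simp add: mean)
  qed
  have sq: "(\<Sum>i\<in>I. Y i \<omega>)\<^sup>2 = (\<Sum>i\<in>I. \<Sum>j\<in>I. Y i \<omega> * Y j \<omega>)" for \<omega>
    by (simp add: power2_eq_square sum_product)
  show "integrable M (\<lambda>\<omega>. (\<Sum>i\<in>I. Y i \<omega>)\<^sup>2)"
    unfolding sq using cross by (auto intro!: Bochner_Integration.integrable_sum)
  have "expectation (\<lambda>\<omega>. (\<Sum>i\<in>I. Y i \<omega>)\<^sup>2) = (\<Sum>i\<in>I. \<Sum>j\<in>I. expectation (\<lambda>\<omega>. Y i \<omega> * Y j \<omega>))"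
    unfolding sq using cross
    by (subst Bochner_Integration.integral_sum; (intro sum.cong refl Bochner_Integration.integral_sum Bochner_Integration.integrable_sum)?) auto
  also have "\<dots> = (\<Sum>i\<in>I. expectation (\<lambda>\<omega>. (Y i \<omega>)\<^sup>2))"
    using cross fin by (intro sum.cong refl) (simp add: sum.delta')
  finally show "expectation (\<lambda>\<omega>. (\<Sum>i\<in>I. Y i \<omega>)\<^sup>2) = (\<Sum>i\<in>I. expectation (\<lambda>\<omega>. (Y i \<omega>)\<^sup>2))" .
qed

text \<open>
  The powers of two below \<open>w\<close> add up to less than twice the largest of them.
\<close>

lemma dyadic_tail_bound:
  fixes w :: real
  assumes "0 \<le> w"
  shows "(\<Sum>m<N. 2 ^ m * indicator {2 ^ m<..} w) \<le> 2 * w"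
proof -
  \<comment> \<open>The second bound of the minimum is what makes the induction go through.\<close>
  have "(\<Sum>m<N. 2 ^ m * indicator {2 ^ m<..} w) \<le> min (2 * w) (2 ^ N)"
    using assms by (induction N) (auto simp: indicator_def)
  then show ?thesis by simp
qed

text \<open>
  Here the sum runs over the powers of two from \<open>w\<close> on, where the terms halve from one to the
  next and the first is at most \<open>w\<close>.
\<close>

lemma dyadic_truncated_square_bound:
  fixes w :: real
  assumes "0 \<le> w"
  shows "(\<Sum>m<N. w\<^sup>2 * indicator {..2 ^ m} w / 2 ^ m) \<le> 2 * w"
proof -
  let ?T = "\<lambda>N. \<Sum>m<N. w\<^sup>2 * indicator {..2 ^ m} w / 2 ^ m"
  \<comment> \<open>All terms with \<open>2 ^ m < w\<close> vanish; after that the subtracted term is the slack for the next step.\<close>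
  have "?T N = 0 \<or> ?T N \<le> 2 * w - 2 * w\<^sup>2 / 2 ^ N"
  proof (induction N)
    case (Suc N)
    show ?case
    proof (cases "w \<le> 2 ^ N")
      case True
      have "w * w \<le> w * 2 ^ N" using True assms by (intro mult_left_mono)
      then have "w\<^sup>2 / 2 ^ N \<le> w" by (simp add: field_simps power2_eq_square)
      moreover have "?T (Suc N) = ?T N + w\<^sup>2 / 2 ^ N" using True by simp
      moreover have "2 * w\<^sup>2 / 2 ^ Suc N = w\<^sup>2 / 2 ^ N" "2 * w\<^sup>2 / 2 ^ N = w\<^sup>2 / 2 ^ N + w\<^sup>2 / 2 ^ N"
        by simp_all
      ultimately show ?thesis using Suc.IH by linarith
    next
      case False
      have "?T (Suc N) = 0"
      proof (intro sum.neutral ballI)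
        fix m assume "m \<in> {..<Suc N}"
        then have "(2::real) ^ m \<le> 2 ^ N" by (intro power_increasing) auto
        then have "\<not> w \<le> 2 ^ m" using False by linarith
        then show "w\<^sup>2 * indicator {..2 ^ m} w / 2 ^ m = 0" by simp
      qed
      then show ?thesis ..
    qed
  qed simp
  moreover have "0 \<le> 2 * w\<^sup>2 / 2 ^ N" by simp
  ultimately show ?thesis using assms by linarith
qed

definition emp_mean :: "nat \<Rightarrow> (nat \<Rightarrow> 'b) \<Rightarrow> ('b \<Rightarrow> real) \<Rightarrow> real" where
  "emp_mean n xs f = (\<Sum>i = 1..n. f (xs i)) / real n"

lemma emp_mean_mono:
  assumes "\<And>i. 1 \<le> i \<Longrightarrow> f (xs i) \<le> g (xs i)"
  shows "emp_mean n xs f \<le> emp_mean n xs g"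
  unfolding emp_mean_def using assms by (intro divide_right_mono sum_mono) auto

lemma emp_mean_add: "emp_mean n xs (\<lambda>t. f t + g t) = emp_mean n xs f + emp_mean n xs g"
  by (simp add: emp_mean_def sum.distrib add_divide_distrib)

lemma emp_mean_cmult: "emp_mean n xs (\<lambda>t. c * f t) = c * emp_mean n xs f"
  by (simp add: emp_mean_def sum_distrib_left)

lemma emp_mean_sum: "emp_mean n xs (\<lambda>t. \<Sum>j\<in>J. f j t) = (\<Sum>j\<in>J. emp_mean n xs (f j))"
  unfolding emp_mean_def by (subst sum.swap) (simp add: sum_divide_distrib)

lemma sum_eq_emp_mean: "0 < n \<Longrightarrow> (\<Sum>i = 1..n. f (xs i)) = real n * emp_mean n xs f"
  by (simp add: emp_mean_def)

lemma emp_mean_const: "0 < n \<Longrightarrow> emp_mean n xs (\<lambda>_. c) = c"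
  by (simp add: emp_mean_def)

text \<open>
  The law of the observations is a parameter of its own, so that truncating an observation means
  composing with a function and expectations become integrals against one measure.
\<close>

locale iid_sample = prob_space M
  for M :: "'a measure" and X :: "nat \<Rightarrow> 'a \<Rightarrow> real" and D :: "real measure" +
  assumes indep: "indep_vars (\<lambda>_. borel) X {1..}"
    and law_X: "\<And>i. 1 \<le> i \<Longrightarrow> distr M borel (X i) = D"
begin

lemma rv_X [measurable]: "1 \<le> i \<Longrightarrow> X i \<in> borel_measurable M"
  using indep by (auto simp: indep_vars_def)

lemma sets_D [measurable_cong]: "sets D = sets borel"
  using law_X[of 1] by auto

lemma prob_space_D: "prob_space D"
  using prob_space_distr[OF rv_X[of 1]] law_X[of 1] by simp

lemma integral_X:
  fixes f :: "real \<Rightarrow> real"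
  assumes [measurable]: "f \<in> borel_measurable borel" and "1 \<le> i"
  shows "expectation (\<lambda>\<omega>. f (X i \<omega>)) = integral\<^sup>L D f"
  using assms(2) by (simp add: law_X[symmetric] integral_distr)

lemma integrable_X:
  fixes f :: "real \<Rightarrow> real"
  assumes [measurable]: "f \<in> borel_measurable borel" and "1 \<le> i"
  shows "integrable M (\<lambda>\<omega>. f (X i \<omega>)) \<longleftrightarrow> integrable D f"
  using assms(2) by (simp add: law_X[symmetric] integrable_distr_eq)

lemma prob_X:
  assumes "A \<in> sets borel" and "1 \<le> i"
  shows "prob {\<omega> \<in> space M. X i \<omega> \<in> A} = measure D A"
proof -
  have "{\<omega> \<in> space M. X i \<omega> \<in> A} = X i -` A \<inter> space M" by auto
  then show ?thesis
    using assms by (simp add: law_X[OF assms(2), symmetric] measure_distr)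
qed

lemma emp_mean_measurable [measurable]:
  assumes [measurable]: "f \<in> borel_measurable borel"
  shows "(\<lambda>\<omega>. emp_mean n (\<lambda>i. X i \<omega>) f) \<in> borel_measurable M"
  unfolding emp_mean_def by simp

lemma distr_image: assumes f[measurable]: "f \<in> borel_measurable borel" and j: "1 \<le> j"
  shows "distr M borel (\<lambda>\<omega>. f (X j \<omega>)) = distr D borel (f::real\<Rightarrow>real)"
  using distr_distr[of f borel borel "X j" M] rv_X[OF j] f by (simp add: law_X[OF j] comp_def)

lemma emp_mean_Hoeffding:
  fixes f :: "real \<Rightarrow> real"
  assumes f[measurable]: "f \<in> borel_measurable borel" and fC: "\<And>x. f x \<in> {0..C}"
  and C: "0 < C" and n: "0 < n" and e: "0 < e"
  shows "prob {\<omega> \<in> space M. \<bar>emp_mean n (\<lambda>i. X i \<omega>) f - integral\<^sup>L D f\<bar> \<ge> e} \<le> 2 * exp (- 2 * real n * e\<^sup>2 / C\<^sup>2)"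
    proof -
      interpret H: Hoeffding_ineq_iid M "{1..n}" "\<lambda>i \<omega>. f (X i \<omega>)" "\<lambda>\<omega>. f (X 1 \<omega>)" 0 C
        "expectation (\<lambda>\<omega>. f (X 1 \<omega>))"
      proof unfold_locales
        show "indep_vars (\<lambda>_. borel) (\<lambda>i \<omega>. f (X i \<omega>)) {1..n}"
          by (rule indep_vars_compose2[OF indep_vars_subset[OF indep]]) auto
        show "distr M borel (\<lambda>\<omega>. f (X i \<omega>)) = distr M borel (\<lambda>\<omega>. f (X 1 \<omega>))"
          if "i \<in> {1..n}" for i
          using that distr_image[OF f, of i] distr_image[OF f, of 1] by simp
        show "(\<lambda>\<omega>. f (X 1 \<omega>)) \<in> borel_measurable M"
          by (rule measurable_compose[OF rv_X f]) simp
        show "AE \<omega> in M. f (X 1 \<omega>) \<in> {0..C}" using fC by blast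
      qed simp
      have ex: "expectation (\<lambda>\<omega>. f (X 1 \<omega>)) = integral\<^sup>L D f" by (rule integral_X[OF f]) simp
      show ?thesis
        using H.Hoeffding_ineq_abs_ge'[of e] e C n by (simp add: ex[simplified] emp_mean_def)
    qed

text \<open>
  Hoeffding's inequality gives exponentially small deviation probabilities, hence summable ones.
\<close>

lemma bounded_strong_law:
  fixes f :: "real \<Rightarrow> real"
  assumes f[measurable]: "f \<in> borel_measurable borel" and b: "\<And>x. f x \<in> {0..B}"
  shows "AE \<omega> in M. (\<lambda>n. emp_mean n (\<lambda>i. X i \<omega>) f) \<longlonglongrightarrow> integral\<^sup>L D f"
proof -
  let ?E = "\<lambda>n \<omega>. emp_mean n (\<lambda>i. X i \<omega>) f" and ?\<mu> = "integral\<^sup>L D f"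
  \<comment> \<open>Hoeffding's inequality asks for an interval of positive length.\<close>
  define C where "C = B + 1"
  have "0 \<le> B" using b[of 0] by auto
  then have C: "0 < C" by (simp add: C_def)
  have fC: "f x \<in> {0..C}" for x using b[of x] by (auto simp: C_def)
  have dev: "AE \<omega> in M. eventually (\<lambda>n. \<bar>?E n \<omega> - ?\<mu>\<bar> < e) sequentially" if e: "0 < e" for e
  proof -
    define A where "A n = {\<omega> \<in> space M. \<bar>?E n \<omega> - ?\<mu>\<bar> \<ge> e}" for n
    define r where "r = exp (- 2 * e\<^sup>2 / C\<^sup>2)"
    have r: "0 \<le> r" "r < 1" using e C by (auto simp: r_def)
    have A[measurable]: "A n \<in> sets M" for n unfolding A_def by measurable
    have bound: "prob (A n) \<le> 2 * r ^ n" if n: "0 < n" for n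
    proof -
      have "exp (- 2 * real n * e\<^sup>2 / C\<^sup>2) = r ^ n"
        unfolding r_def by (subst exp_of_nat_mult[symmetric]) (simp add: mult_ac)
      then show ?thesis using emp_mean_Hoeffding[OF f fC C n e] by (simp add: A_def)
    qed
    have "summable (\<lambda>n. prob (A n))"
    proof (rule summable_comparison_test_ev)
      show "eventually (\<lambda>n. norm (prob (A n)) \<le> 2 * r ^ n) sequentially"
        using eventually_gt_at_top[of 0] by eventually_elim (use bound in auto)
      show "summable (\<lambda>n. 2 * r ^ n)" using r by (intro summable_mult summable_geometric) auto
    qed
    then have "AE \<omega> in M. eventually (\<lambda>n. \<omega> \<in> space M - A n) sequentially"
      by (intro borel_cantelli_AE1) (auto simp: emeasure_eq_measure)
    then show ?thesis
      by eventually_elim (auto simp: A_def not_le elim!: eventually_mono)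
  qed
  have "AE \<omega> in M. \<forall>m. eventually (\<lambda>n. \<bar>?E n \<omega> - ?\<mu>\<bar> < 1 / real (Suc m)) sequentially"
    by (subst AE_all_countable) (intro allI dev, simp)
  then show ?thesis
  proof eventually_elim
    case (elim \<omega>)
    show ?case
    proof (rule tendstoI)
      fix e :: real assume "0 < e"
      then obtain m where m: "1 / real (Suc m) < e" using nat_approx_posE by blast
      show "eventually (\<lambda>n. dist (?E n \<omega>) ?\<mu> < e) sequentially"
        using elim[rule_format, of m] by eventually_elim (use m in \<open>auto simp: dist_real_def\<close>)
    qed
  qed
qed

text \<open>
  Either some observation has \<open>f\<close> above \<open>n\<close>, which the first term bounds, or all observations
  agree with their truncations at level \<open>n\<close>, and then Chebyshev's inequality for the truncated
  sum gives the second term.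
\<close>

lemma truncated_mean_deviation:
  fixes f :: "real \<Rightarrow> real"
  assumes f[measurable]: "f \<in> borel_measurable borel" and nn: "\<And>x. 0 \<le> f x"
    and int: "integrable D f" and e: "0 < e" and n: "0 < n"
  shows "prob {\<omega> \<in> space M. emp_mean n (\<lambda>i. X i \<omega>) f \<ge> integral\<^sup>L D f + e}
    \<le> (\<integral>x. real n * indicator {real n<..} (f x) \<partial>D)
      + (\<integral>x. (f x)\<^sup>2 * indicator {..real n} (f x) / real n \<partial>D) / e\<^sup>2"
proof -
  interpret D: prob_space D by (rule prob_space_D)
  define g where "g x = f x * indicator {..real n} (f x)" for x
  have g[measurable]: "g \<in> borel_measurable borel" unfolding g_def by measurable
  have gb: "0 \<le> g x" "g x \<le> real n" "g x \<le> f x" for x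
    using nn[of x] by (auto simp: g_def indicator_def)
  have intg: "integrable D g" using gb by (intro D.integrable_const_bound[of _ "real n"]) (auto simp: sets_D)
  have intg2: "integrable D (\<lambda>x. (g x)\<^sup>2)"
    using gb by (intro D.integrable_const_bound[of _ "(real n)\<^sup>2"]) (auto simp: sets_D intro!: power_mono)
  define \<mu> where "\<mu> = integral\<^sup>L D g"
  have \<mu>: "\<mu> \<le> integral\<^sup>L D f" unfolding \<mu>_def using gb intg int by (intro integral_mono) auto
  define Y where "Y = (\<lambda>i \<omega>. g (X i \<omega>) - \<mu>)"
  have ind: "indep_vars (\<lambda>_. borel) Y {1..n}"
    unfolding Y_def by (rule indep_vars_compose2[OF indep_vars_subset[OF indep]]) auto
  have intY: "integrable M (Y i)" and meanY: "expectation (Y i) = 0" if "i \<in> {1..n}" for i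
    using that intg integrable_X[of g i] integral_X[of g i] by (auto simp: Y_def \<mu>_def prob_space)
  have Y2: "(Y i \<omega>)\<^sup>2 = (g (X i \<omega>))\<^sup>2 - 2 * \<mu> * g (X i \<omega>) + \<mu>\<^sup>2" for i \<omega>
    by (simp add: Y_def power2_diff)
  have intgX: "integrable M (\<lambda>\<omega>. g (X i \<omega>))" "integrable M (\<lambda>\<omega>. (g (X i \<omega>))\<^sup>2)" if "i \<in> {1..n}" for i
    using that intg intg2 integrable_X[of "\<lambda>x. (g x)\<^sup>2" i] integrable_X[of g i] by auto
  have intY2: "integrable M (\<lambda>\<omega>. (Y i \<omega>)\<^sup>2)" if "i \<in> {1..n}" for i
    unfolding Y2 using intgX[OF that] by auto
  have varY: "expectation (\<lambda>\<omega>. (Y i \<omega>)\<^sup>2) \<le> (\<integral>x. (g x)\<^sup>2 \<partial>D)" if i: "i \<in> {1..n}" for i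
  proof -
    have "expectation (\<lambda>\<omega>. (Y i \<omega>)\<^sup>2) = (\<integral>x. (g x)\<^sup>2 \<partial>D) - 2 * \<mu> * \<mu> + \<mu>\<^sup>2"
      unfolding Y2 using intgX[OF i] i integral_X[of "\<lambda>x. (g x)\<^sup>2" i] integral_X[of g i]
      by (simp add: \<mu>_def prob_space)
    then show ?thesis by (simp add: power2_eq_square)
  qed
  define S where "S \<omega> = (\<Sum>i=1..n. Y i \<omega>)" for \<omega>
  have S[measurable]: "S \<in> borel_measurable M" unfolding S_def Y_def by simp
  have S2: "integrable M (\<lambda>\<omega>. (S \<omega>)\<^sup>2)"
    and ES2: "expectation (\<lambda>\<omega>. (S \<omega>)\<^sup>2) = (\<Sum>i=1..n. expectation (\<lambda>\<omega>. (Y i \<omega>)\<^sup>2))"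
    unfolding S_def using second_moment_sum_centered[OF _ ind intY intY2 meanY] by auto
  have ES: "expectation S = 0" unfolding S_def using intY meanY by simp
  let ?A = "{\<omega> \<in> space M. emp_mean n (\<lambda>i. X i \<omega>) f \<ge> integral\<^sup>L D f + e}"
  let ?B = "\<lambda>i. {\<omega> \<in> space M. X i \<omega> \<in> f -` {real n<..}}"
  let ?C = "{\<omega> \<in> space M. \<bar>S \<omega> - expectation S\<bar> \<ge> real n * e}"
  have vim: "f -` {real n<..} \<in> sets borel" using measurable_sets[OF f, of "{real n<..}"] by simp
  have Bm: "?B i \<in> sets M" if "i \<in> {1..n}" for i
    using measurable_sets[OF rv_X vim, of i] that by (simp add: vimage_def Int_def conj_commute)
  have sub: "?A \<subseteq> (\<Union>i\<in>{1..n}. ?B i) \<union> ?C"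
  proof
    fix \<omega> assume w: "\<omega> \<in> ?A"
    show "\<omega> \<in> (\<Union>i\<in>{1..n}. ?B i) \<union> ?C"
    proof (cases "\<exists>i\<in>{1..n}. real n < f (X i \<omega>)")
      case True then show ?thesis using w by auto
    next
      case False
      then have "g (X i \<omega>) = f (X i \<omega>)" if "i \<in> {1..n}" for i using that by (auto simp: g_def not_less)
      then have "S \<omega> = (\<Sum>i=1..n. f (X i \<omega>)) - real n * \<mu>" by (simp add: S_def Y_def sum_subtractf)
      moreover have "(\<Sum>i=1..n. f (X i \<omega>)) \<ge> real n * (integral\<^sup>L D f + e)"
        using w n by (simp add: emp_mean_def field_simps)
      moreover have "real n * \<mu> \<le> real n * integral\<^sup>L D f" using \<mu> by (intro mult_left_mono) auto
      ultimately have "S \<omega> \<ge> real n * e" by (simp add: algebra_simps)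
      then show ?thesis using w by (auto simp: ES)
    qed
  qed
  have meas: "(\<Union>i\<in>{1..n}. ?B i) \<in> sets M" "?C \<in> sets M" using Bm by (auto intro!: sets.finite_UN)
  have tail: "prob (\<Union>i\<in>{1..n}. ?B i) \<le> (\<integral>x. real n * indicator {real n<..} (f x) \<partial>D)"
  proof -
    have "prob (\<Union>i\<in>{1..n}. ?B i) \<le> (\<Sum>i\<in>{1..n}. prob (?B i))"
      using Bm by (intro finite_measure_subadditive_finite) auto
    also have "\<dots> = real n * measure D (f -` {real n<..})"
      using prob_X[OF vim] by simp
    also have "measure D (f -` {real n<..}) = (\<integral>x. indicat_real (f -` {real n<..}) x \<partial>D)"
      using vim by (simp add: sets_D sets_eq_imp_space_eq[OF sets_D])
    also have "\<dots> = (\<integral>x. indicat_real {real n<..} (f x) \<partial>D)"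
      by (intro Bochner_Integration.integral_cong) (auto simp: indicator_def)
    finally show ?thesis by simp
  qed
  have "prob ?C \<le> variance S / (real n * e)\<^sup>2"
    using S2 e n by (intro Chebyshev_inequality) auto
  also have "\<dots> \<le> real n * (\<integral>x. (g x)\<^sup>2 \<partial>D) / (real n * e)\<^sup>2"
    using sum_mono[OF varY, of "{1..n}"] by (intro divide_right_mono) (simp_all add: ES ES2)
  also have "\<dots> = (\<integral>x. (g x)\<^sup>2 / real n \<partial>D) / e\<^sup>2"
    using n e by (simp add: power2_eq_square)
  also have "(\<integral>x. (g x)\<^sup>2 / real n \<partial>D) = (\<integral>x. (f x)\<^sup>2 * indicator {..real n} (f x) / real n \<partial>D)"
    by (intro Bochner_Integration.integral_cong) (auto simp: g_def indicator_def)
  finally have dev: "prob ?C \<le> (\<integral>x. (f x)\<^sup>2 * indicator {..real n} (f x) / real n \<partial>D) / e\<^sup>2" .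
  have "prob ?A \<le> prob ((\<Union>i\<in>{1..n}. ?B i) \<union> ?C)"
    using meas by (intro finite_measure_mono sub) auto
  also have "\<dots> \<le> prob (\<Union>i\<in>{1..n}. ?B i) + prob ?C" using meas by (intro measure_Un_le)
  finally show ?thesis using tail dev by linarith
qed

text \<open>
  Along the sample sizes \<open>2\<^sup>m\<close> the deviation probabilities are summable, because both series of
  bounds add up to at most a multiple of \<open>f\<close> pointwise. Since \<open>f \<ge> 0\<close>, an average is at most
  twice the average at the next such size.
\<close>

lemma strong_law_within_factor_2:
  fixes f :: "real \<Rightarrow> real"
  assumes f[measurable]: "f \<in> borel_measurable borel" and nn: "\<And>x. 0 \<le> f x"
    and int: "integrable D f" and e: "0 < e"
  shows "AE \<omega> in M. eventually (\<lambda>n. emp_mean n (\<lambda>i. X i \<omega>) f \<le> 2 * (integral\<^sup>L D f + e)) sequentially"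
proof -
  interpret D: prob_space D by (rule prob_space_D)
  define A where "A m = {\<omega> \<in> space M. emp_mean (2 ^ m) (\<lambda>i. X i \<omega>) f \<ge> integral\<^sup>L D f + e}" for m
  have A[measurable]: "A m \<in> sets M" for m unfolding A_def by measurable
  define u where "u m x = 2 ^ m * indicator {2 ^ m<..} (f x) + (f x)\<^sup>2 * indicator {..2 ^ m} (f x) / 2 ^ m / e\<^sup>2"
    for m :: nat and x
  have int1: "integrable D (\<lambda>x. 2 ^ m * indicator {2 ^ m<..} (f x) :: real)" for m :: nat
    by (intro D.integrable_const_bound[of _ "2 ^ m"]) (auto simp: sets_D indicator_def)
  have int2: "integrable D (\<lambda>x. (f x)\<^sup>2 * indicator {..2 ^ m} (f x) / 2 ^ m :: real)" for m :: nat
    using nn by (intro D.integrable_const_bound[of _ "(2 ^ m)\<^sup>2 / 2 ^ m"])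
      (auto simp: sets_D indicator_def intro!: power_mono divide_right_mono)
  have intu: "integrable D (u m)" for m
    unfolding u_def by (intro Bochner_Integration.integrable_add integrable_divide int1 int2)
  have Au: "prob (A m) \<le> integral\<^sup>L D (u m)" for m
  proof -
    have "integral\<^sup>L D (u m) = (\<integral>x. 2 ^ m * indicator {2 ^ m<..} (f x) \<partial>D)
        + (\<integral>x. (f x)\<^sup>2 * indicator {..2 ^ m} (f x) / 2 ^ m \<partial>D) / e\<^sup>2"
      unfolding u_def
      by (subst Bochner_Integration.integral_add[OF int1 integrable_divide[OF int2]]) simp
    then show ?thesis
      using truncated_mean_deviation[OF f nn int e, of "2 ^ m"] unfolding A_def by simp
  qed
  have u0: "0 \<le> u m x" for m x by (simp add: u_def)
  have usum: "(\<Sum>m<N. u m x) \<le> (2 + 2 / e\<^sup>2) * f x" for N x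
  proof -
    have "(\<Sum>m<N. u m x) = (\<Sum>m<N. 2 ^ m * indicator {2 ^ m<..} (f x))
        + (\<Sum>m<N. (f x)\<^sup>2 * indicator {..2 ^ m} (f x) / 2 ^ m) / e\<^sup>2"
      by (simp add: u_def sum.distrib sum_divide_distrib)
    also have "\<dots> \<le> 2 * f x + 2 * f x / e\<^sup>2"
      by (intro add_mono divide_right_mono dyadic_tail_bound dyadic_truncated_square_bound nn) auto
    finally show ?thesis by (simp add: algebra_simps)
  qed
  have "summable (\<lambda>m. integral\<^sup>L D (u m))"
  proof (rule summableI_nonneg_bounded)
    show "0 \<le> integral\<^sup>L D (u m)" for m using u0 by simp
    show "(\<Sum>m<N. integral\<^sup>L D (u m)) \<le> (2 + 2 / e\<^sup>2) * integral\<^sup>L D f" for N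
    proof -
      have "(\<Sum>m<N. integral\<^sup>L D (u m)) = (\<integral>x. (\<Sum>m<N. u m x) \<partial>D)" using intu by simp
      also have "\<dots> \<le> (\<integral>x. (2 + 2 / e\<^sup>2) * f x \<partial>D)"
        using intu int usum by (intro integral_mono) auto
      finally show ?thesis by simp
    qed
  qed
  then have "summable (\<lambda>m. prob (A m))"
    by (rule summable_comparison_test_ev[rotated]) (use Au in auto)
  then have "AE \<omega> in M. eventually (\<lambda>m. \<omega> \<in> space M - A m) sequentially"
    by (intro borel_cantelli_AE1) (auto simp: emeasure_eq_measure)
  then show ?thesis
  proof eventually_elim
    case (elim \<omega>)
    then obtain m0 where m0: "\<And>m. m0 \<le> m \<Longrightarrow> \<omega> \<in> space M - A m"
      by (auto simp: eventually_sequentially)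
    have "emp_mean n (\<lambda>i. X i \<omega>) f \<le> 2 * (integral\<^sup>L D f + e)" if n: "2 ^ m0 \<le> n" for n
    proof -
      have "0 < n" using n by (metis gr0I le_zero_eq power_not_zero zero_neq_numeral)
      then obtain m where m: "2 ^ m \<le> n" "n < 2 ^ Suc m" using ex_power_ivl1[of 2 n] by auto
      have "2 ^ m0 < (2::nat) ^ Suc m" using n m by linarith
      then have "m0 \<le> Suc m" using power_less_imp_less_exp[of "2::nat" m0 "Suc m"] by simp
      have bd: "emp_mean (2 ^ Suc m) (\<lambda>i. X i \<omega>) f \<le> integral\<^sup>L D f + e"
        using m0[OF \<open>m0 \<le> Suc m\<close>] by (auto simp: A_def)
      define N where "N = (2::nat) ^ Suc m"
      have N: "n < N" "N \<le> 2 * n" using m by (auto simp: N_def)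
      have "(\<Sum>i = 1..n. f (X i \<omega>)) \<le> (\<Sum>i = 1..N. f (X i \<omega>))"
        using N nn by (intro sum_mono2) auto
      also have "\<dots> = real N * emp_mean N (\<lambda>i. X i \<omega>) f"
        using N by (intro sum_eq_emp_mean) simp
      also have "\<dots> \<le> real N * (integral\<^sup>L D f + e)"
        using bd by (intro mult_left_mono) (auto simp: N_def)
      also have "\<dots> \<le> real (2 * n) * (integral\<^sup>L D f + e)"
        using nn e N by (intro mult_right_mono) (auto intro!: add_nonneg_nonneg simp del: of_nat_mult)
      finally have "real n * emp_mean n (\<lambda>i. X i \<omega>) f \<le> real n * (2 * (integral\<^sup>L D f + e))"
        using sum_eq_emp_mean[OF \<open>0 < n\<close>, of f "\<lambda>i. X i \<omega>"] by (simp add: algebra_simps)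
      then show ?thesis using \<open>0 < n\<close> by (simp only: mult_le_cancel_left_pos of_nat_0_less_iff)
    qed
    then show ?case by (auto simp: eventually_sequentially)
  qed
qed

text \<open>
  The bounded part \<open>min f K\<close> obeys the bounded strong law; the rest has small mean for large \<open>K\<close>,
  so a bound on its averages that is off by a factor of two is good enough.
\<close>

theorem strong_law_nonneg:
  fixes f :: "real \<Rightarrow> real"
  assumes f[measurable]: "f \<in> borel_measurable borel" and nn: "\<And>x. 0 \<le> f x"
    and int: "integrable D f"
  shows "AE \<omega> in M. (\<lambda>n. emp_mean n (\<lambda>i. X i \<omega>) f) \<longlonglongrightarrow> integral\<^sup>L D f"
proof -
  let ?E = "\<lambda>n \<omega>. emp_mean n (\<lambda>i. X i \<omega>)" and ?\<mu> = "integral\<^sup>L D"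
  define lo where "lo K x = min (f x) (real K)" for K x
  define hi where "hi K x = f x - lo K x" for K x
  have lo[measurable]: "lo K \<in> borel_measurable borel" for K unfolding lo_def by measurable
  have hi[measurable]: "hi K \<in> borel_measurable borel" for K unfolding hi_def by measurable
  have lob: "lo K x \<in> {0..real K}" for K x using nn[of x] by (auto simp: lo_def)
  have hi0: "0 \<le> hi K x" for K x by (auto simp: hi_def lo_def)
  have into: "integrable D (lo K)" for K
    by (rule Bochner_Integration.integrable_bound[OF int]) (use nn in \<open>auto simp: lo_def sets_D\<close>)
  have inthi: "integrable D (hi K)" for K unfolding hi_def using int into by auto
  have mulo: "?\<mu> f = ?\<mu> (lo K) + ?\<mu> (hi K)" for K
    unfolding hi_def using int into by simp
  have hi_lim: "(\<lambda>K. ?\<mu> (hi K)) \<longlonglongrightarrow> 0"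
  proof -
    have "(\<lambda>K. ?\<mu> (hi K)) \<longlonglongrightarrow> (\<integral>x. 0 \<partial>D)"
    proof (rule integral_dominated_convergence[where w = f])
      show "AE x in D. (\<lambda>K. hi K x) \<longlonglongrightarrow> 0"
      proof (rule AE_I2)
        fix x
        obtain N where N: "f x \<le> real N" using real_arch_simple by blast
        have "eventually (\<lambda>K. hi K x = 0) sequentially"
          using eventually_ge_at_top[of N] by eventually_elim (use N in \<open>auto simp: hi_def lo_def\<close>)
        then show "(\<lambda>K. hi K x) \<longlonglongrightarrow> 0" by (rule tendsto_eventually)
      qed
      show "AE x in D. norm (hi K x) \<le> f x" for K
        using nn by (auto simp: hi_def lo_def min_def)
    qed (use int in \<open>auto simp: sets_D\<close>)
    then show ?thesis by simp
  qed
  have "AE \<omega> in M. (\<lambda>n. ?E n \<omega> (lo K)) \<longlonglongrightarrow> ?\<mu> (lo K)" for K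
    by (rule bounded_strong_law[OF lo lob])
  then have "AE \<omega> in M. \<forall>K. (\<lambda>n. ?E n \<omega> (lo K)) \<longlonglongrightarrow> ?\<mu> (lo K)"
    by (simp only: AE_all_countable simp_thms)
  moreover have "AE \<omega> in M. eventually (\<lambda>n. ?E n \<omega> (hi K) \<le> 2 * (?\<mu> (hi K) + 1 / real (Suc m))) sequentially"
    for K m
    by (rule strong_law_within_factor_2[OF hi hi0 inthi]) simp
  then have "AE \<omega> in M. \<forall>K m. eventually (\<lambda>n. ?E n \<omega> (hi K) \<le> 2 * (?\<mu> (hi K) + 1 / real (Suc m))) sequentially"
    by (simp only: AE_all_countable simp_thms)
  ultimately show ?thesis
  proof eventually_elim
    case (elim \<omega>)
    show ?case
    proof (rule tendstoI)
      fix e :: real assume e: "0 < e"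
      \<comment> \<open>The average of \<open>hi K\<close> can reach \<open>2 * (e / 6 + e / 6)\<close>, and that of \<open>lo K\<close> is off by at most \<open>e / 6\<close>.\<close>
      from e have e6: "0 < e / 6" by simp
      then have "eventually (\<lambda>K. ?\<mu> (hi K) < e / 6) sequentially"
        by (rule order_tendstoD(2)[OF hi_lim])
      then obtain K where K: "?\<mu> (hi K) < e / 6"
        using eventually_happens'[OF sequentially_bot] by blast
      from e6 obtain m where m: "1 / real (Suc m) < e / 6" using nat_approx_posE by blast
      have "eventually (\<lambda>n. dist (?E n \<omega> (lo K)) (?\<mu> (lo K)) < e / 6) sequentially"
        using elim(1)[rule_format, of K] e by (intro tendstoD) auto
      with elim(2)[rule_format, of K m]
      show "eventually (\<lambda>n. dist (?E n \<omega> f) (?\<mu> f) < e) sequentially"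
      proof eventually_elim
        case (elim n)
        have "?E n \<omega> f = ?E n \<omega> (lo K) + ?E n \<omega> (hi K)"
          by (simp add: emp_mean_add[symmetric] hi_def)
        moreover have "0 \<le> ?E n \<omega> (hi K)" by (auto simp: emp_mean_def hi0 sum_nonneg)
        moreover have "0 \<le> ?\<mu> (hi K)" using hi0 by simp
        moreover have "?E n \<omega> (lo K) < ?\<mu> (lo K) + e / 6" "?\<mu> (lo K) - e / 6 < ?E n \<omega> (lo K)"
          using elim(2) unfolding dist_real_def abs_diff_less_iff by auto
        moreover have "?E n \<omega> (hi K) \<le> 2 * (e / 6 + e / 6)"
          using elim(1) K m by (meson add_mono less_imp_le mult_left_mono order_trans zero_le_numeral)
        moreover have "2 * (e / 6 + e / 6) + e / 6 < e" using e by simp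
        ultimately have "\<bar>?E n \<omega> f - ?\<mu> f\<bar> < e"
          using K mulo[of K] unfolding abs_diff_less_iff by (intro conjI) linarith+
        then show ?case by (simp add: dist_real_def)
      qed
    qed
  qed
qed

end

section \<open>Subgradients of convex functions on the half-line\<close>

definition slope :: "(real \<Rightarrow> real) \<Rightarrow> real \<Rightarrow> real \<Rightarrow> real" where
  "slope f x y = (f y - f x) / (y - x)"

lemma slope_commute: "slope f x y = slope f y x"
  unfolding slope_def by (metis minus_diff_eq minus_divide_divide)

lemma convex_slope_mono:
  assumes f: "convex_on {0<..} f" and x: "0 < x" and y: "0 < y" "y \<noteq> x" and z: "z \<noteq> x" and yz: "y \<le> z"
  shows "slope f x y \<le> slope f x z"
proof (cases "y = z")
  case False
  have S: "slope f a b \<le> slope f a c" "slope f a c \<le> slope f b c" if "0 < a" "a < b" "b < c" for a b c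
  proof -
    have "slope f b a \<le> slope f c a" "slope f c a \<le> slope f c b"
      using convex_on_slope_le[OF f, of a c b] that by (simp_all add: slope_def)
    then show "slope f a b \<le> slope f a c" "slope f a c \<le> slope f b c" by (metis slope_commute)+
  qed
  consider "x < y" | "y < x" "x < z" | "z < x" using y z by linarith
  then show ?thesis
  proof cases
    case 1 then show ?thesis using S(1)[of x y z] x y yz False by auto
  next
    case 2 then show ?thesis using S(1)[of y x z] S(2)[of y x z] y by (simp add: slope_commute[of f x y])
  next
    case 3 then show ?thesis using S(2)[of y z x] y yz False by (simp add: slope_commute[of f x])
  qed
qed simp

text \<open>
  Only points of the open half-line, where the functions of interest are convex, are tested.
\<close>

definition subgradient_at :: "(real \<Rightarrow> real) \<Rightarrow> real \<Rightarrow> real \<Rightarrow> bool" where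
  "subgradient_at f x d \<longleftrightarrow> (\<forall>y>0. f x + d * (y - x) \<le> f y)"

lemma subgradient_at_slope:
  assumes "0 < x"
  shows "subgradient_at f x d \<longleftrightarrow> (\<forall>y>x. d \<le> slope f x y) \<and> (\<forall>y. 0 < y \<and> y < x \<longrightarrow> slope f x y \<le> d)"
proof -
  have R: "f x + d * (y - x) \<le> f y \<longleftrightarrow> d \<le> slope f x y" if "x < y" for y
    using that by (auto simp: slope_def pos_le_divide_eq)
  have L: "f x + d * (y - x) \<le> f y \<longleftrightarrow> slope f x y \<le> d" if "y < x" for y
    using that by (auto simp: slope_def neg_divide_le_eq)
  show ?thesis
  proof
    assume *: "subgradient_at f x d"
    have "d \<le> slope f x y" if "x < y" for y
      using * R[OF that] assms that by (simp add: subgradient_at_def)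
    moreover have "slope f x y \<le> d" if "0 < y" "y < x" for y
      using * L[OF that(2)] that by (simp add: subgradient_at_def)
    ultimately show "(\<forall>y>x. d \<le> slope f x y) \<and> (\<forall>y. 0 < y \<and> y < x \<longrightarrow> slope f x y \<le> d)" by blast
  next
    assume *: "(\<forall>y>x. d \<le> slope f x y) \<and> (\<forall>y. 0 < y \<and> y < x \<longrightarrow> slope f x y \<le> d)"
    have "f x + d * (y - x) \<le> f y" if "0 < y" for y
      using * R[of y] L[of y] that by (cases y x rule: linorder_cases) simp_all
    then show "subgradient_at f x d" by (simp add: subgradient_at_def)
  qed
qed

lemma convex_right_derivative_subgradient:
  assumes f: "convex_on {0<..} f" and x: "0 < x" and d: "(f has_real_derivative d) (at_right x)"
  shows "subgradient_at f x d"
proof -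
  have lim: "((\<lambda>y. slope f x y) \<longlongrightarrow> d) (at_right x)"
    using d by (simp add: has_field_derivative_iff slope_def)
  have "d \<le> slope f x y" if y: "x < y" for y
  proof (rule tendsto_upperbound[OF lim])
    show "eventually (\<lambda>t. slope f x t \<le> slope f x y) (at_right x)"
      using eventually_at_right_real[OF y]
      by eventually_elim (use x y in \<open>auto intro!: convex_slope_mono[OF f]\<close>)
  qed simp
  moreover have "slope f x y \<le> d" if y: "0 < y" "y < x" for y
  proof (rule tendsto_lowerbound[OF lim])
    show "eventually (\<lambda>t. slope f x y \<le> slope f x t) (at_right x)"
      using eventually_at_right_less[of x]
      by eventually_elim (use x y in \<open>auto intro!: convex_slope_mono[OF f]\<close>)
  qed simp
  ultimately show ?thesis using x by (simp add: subgradient_at_slope)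
qed

lemma convex_left_derivative_subgradient:
  assumes f: "convex_on {0<..} f" and x: "0 < x" and d: "(f has_real_derivative d) (at_left x)"
  shows "subgradient_at f x d"
proof -
  have lim: "((\<lambda>y. slope f x y) \<longlongrightarrow> d) (at_left x)"
    using d by (simp add: has_field_derivative_iff slope_def)
  have "d \<le> slope f x y" if y: "x < y" for y
  proof (rule tendsto_upperbound[OF lim])
    show "eventually (\<lambda>t. slope f x t \<le> slope f x y) (at_left x)"
      using eventually_at_left_real[OF x]
      by eventually_elim (use x y in \<open>auto intro!: convex_slope_mono[OF f]\<close>)
  qed simp
  moreover have "slope f x y \<le> d" if y: "0 < y" "y < x" for y
  proof (rule tendsto_lowerbound[OF lim])
    show "eventually (\<lambda>t. slope f x y \<le> slope f x t) (at_left x)"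
      using eventually_at_left_real[OF y(2)]
      by eventually_elim (use x y in \<open>auto intro!: convex_slope_mono[OF f]\<close>)
  qed simp
  ultimately show ?thesis using x by (simp add: subgradient_at_slope)
qed

lemma convex_has_right_derivative:
  assumes f: "convex_on {0<..} f" and x: "0 < x"
  shows "\<exists>d. (f has_real_derivative d) (at_right x)"
proof -
  have "(slope f x \<longlongrightarrow> Inf (slope f x ` ({x<..} \<inter> UNIV))) (at x within ({x<..} \<inter> UNIV))"
    by (rule Lim_right_bound[where K = "slope f x (x / 2)"])
      (use x in \<open>auto intro!: convex_slope_mono[OF f]\<close>)
  then show ?thesis by (auto simp: has_field_derivative_iff slope_def[abs_def])
qed

lemma convex_has_left_derivative:
  assumes f: "convex_on {0<..} f" and x: "0 < x"
  shows "\<exists>d. (f has_real_derivative d) (at_left x)"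
proof -
  have "(slope f x \<longlongrightarrow> Sup (slope f x ` ({..<x} \<inter> {0<..}))) (at x within ({..<x} \<inter> {0<..}))"
    by (rule Lim_left_bound[where K = "slope f x (x + 1)"])
      (use x in \<open>auto intro!: convex_slope_mono[OF f]\<close>)
  also have "at x within ({..<x} \<inter> {0<..}) = at_left x"
    using x by (intro at_within_nhd[of x "{0<..}"]) auto
  finally show ?thesis by (auto simp: has_field_derivative_iff slope_def[abs_def])
qed

text \<open>
  A subgradient at \<open>x\<close> lies between the slopes of chords to the left and to the right of \<open>x\<close>.
  These converge to the chord slopes of \<open>G\<close>, which are as close to \<open>D\<close> as desired for short
  chords.
\<close>

lemma subgradients_tendsto_derivative:
  fixes F :: "nat \<Rightarrow> real \<Rightarrow> real"
  assumes lim: "\<And>y. 0 < y \<Longrightarrow> (\<lambda>n. F n y) \<longlonglongrightarrow> G y" and x: "0 < x"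
    and D: "(G has_real_derivative D) (at x)"
    and sub: "\<And>n. subgradient_at (F n) x (d n)"
  shows "d \<longlonglongrightarrow> D"
proof -
  have S: "(slope G x \<longlongrightarrow> D) (at x)" using D by (simp add: has_field_derivative_iff slope_def[abs_def])
  have FS: "(\<lambda>n. slope (F n) x y) \<longlonglongrightarrow> slope G x y" if "0 < y" "y \<noteq> x" for y
    unfolding slope_def using that x by (intro tendsto_intros lim) auto
  show ?thesis
  proof (rule order_tendstoI)
    fix a assume a: "a < D"
    have "eventually (\<lambda>y. a < slope G x y) (at_left x)"
      by (rule order_tendstoD(1)[OF tendsto_mono[OF _ S] a]) (simp add: at_le)
    then have "eventually (\<lambda>y. a < slope G x y \<and> y \<in> {0<..<x}) (at_left x)"
      using eventually_at_left_real[OF x] by eventually_elim auto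
    then obtain y where y: "a < slope G x y" "0 < y" "y < x"
      using eventually_happens'[OF trivial_limit_at_left_real] by fastforce
    have "eventually (\<lambda>n. a < slope (F n) x y) sequentially"
      using y by (intro order_tendstoD(1)[OF FS]) auto
    then show "eventually (\<lambda>n. a < d n) sequentially"
      by eventually_elim (use sub y x in \<open>auto simp: subgradient_at_slope intro: less_le_trans\<close>)
  next
    fix a assume a: "D < a"
    have "eventually (\<lambda>y. slope G x y < a) (at_right x)"
      by (rule order_tendstoD(2)[OF tendsto_mono[OF _ S] a]) (simp add: at_le)
    then have "eventually (\<lambda>y. slope G x y < a \<and> x < y) (at_right x)"
      using eventually_at_right_less[of x] by eventually_elim auto
    then obtain y where y: "slope G x y < a" "x < y"
      using eventually_happens'[OF trivial_limit_at_right_real] by fastforce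
    have "eventually (\<lambda>n. slope (F n) x y < a) sequentially"
      using y x by (intro order_tendstoD(2)[OF FS]) auto
    then show "eventually (\<lambda>n. d n < a) sequentially"
      by eventually_elim (use sub y x in \<open>auto simp: subgradient_at_slope intro: le_less_trans\<close>)
  qed
qed

section \<open>Derivatives of convergent k-monotone functions\<close>

lemma sign_power_cancel: "(- 1) ^ j * ((- 1) ^ j * r) = (r :: real)"
  by (cases "even j") auto

text \<open>
  The sign makes this function nonnegative, nonincreasing and convex for a \<open>k\<close>-monotone \<open>g\<close>.
\<close>

abbreviation signed_deriv :: "nat \<Rightarrow> (real \<Rightarrow> real) \<Rightarrow> real \<Rightarrow> real" where
  "signed_deriv l g x \<equiv> (-1) ^ l * (deriv ^^ l) g x"

lemma k_monotoneD:
  assumes "k_monotone k g" and "l \<le> k - 2"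
  shows k_monotone_nonneg: "0 < x \<Longrightarrow> 0 \<le> signed_deriv l g x"
    and k_monotone_antimono: "0 < x \<Longrightarrow> x \<le> y \<Longrightarrow> signed_deriv l g y \<le> signed_deriv l g x"
    and k_monotone_convex: "convex_on {0<..} (signed_deriv l g)"
  using assms by (auto simp: k_monotone_def monotone_on_def)

lemma k_monotone_has_deriv:
  assumes "k_monotone k g" and "l < k - 2" and "0 < x"
  shows "((deriv ^^ l) g has_real_derivative (deriv ^^ Suc l) g x) (at x)"
  using assms by (auto simp: k_monotone_def DERIV_deriv_iff_real_differentiable)

text \<open>
  In the induction step the derivative of order \<open>j + 1\<close> is, up to sign, a subgradient of the
  convex signed derivative of order \<open>j\<close>, which converges by the induction hypothesis.
\<close>

lemma k_monotone_derivs_tendsto: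
  fixes g :: "nat \<Rightarrow> real \<Rightarrow> real"
  assumes g: "\<And>n. k_monotone k (g n)" and g0: "k_monotone k g0"
    and lim: "\<And>x. 0 < x \<Longrightarrow> (\<lambda>n. g n x) \<longlonglongrightarrow> g0 x"
  shows "j \<le> k - 2 \<Longrightarrow> 0 < x \<Longrightarrow> (\<lambda>n. (deriv ^^ j) (g n) x) \<longlonglongrightarrow> (deriv ^^ j) g0 x"
proof (induction j arbitrary: x)
  case 0
  then show ?case using lim by simp
next
  case (Suc j)
  have hd: "(signed_deriv j h has_real_derivative (-1) ^ j * (deriv ^^ Suc j) h x) (at x)"
    if "k_monotone k h" for h
    using k_monotone_has_deriv[OF that, of j x] Suc.prems by (intro DERIV_cmult) auto
  have "(\<lambda>n. (-1) ^ j * (deriv ^^ Suc j) (g n) x) \<longlonglongrightarrow> (-1) ^ j * (deriv ^^ Suc j) g0 x"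
  proof (rule subgradients_tendsto_derivative[OF _ Suc.prems(2) hd[OF g0]])
    show "(\<lambda>n. signed_deriv j (g n) y) \<longlonglongrightarrow> signed_deriv j g0 y" if "0 < y" for y
      using that Suc by (intro tendsto_intros Suc.IH) auto
    show "subgradient_at (signed_deriv j (g n)) x ((-1) ^ j * (deriv ^^ Suc j) (g n) x)" for n
      using Suc.prems hd[OF g, of n] k_monotone_convex[OF g, of j n]
      by (intro convex_right_derivative_subgradient) (auto intro: has_field_derivative_at_within)
  qed
  from tendsto_mult_left[OF this, of "(-1) ^ j"] show ?case
    by (simp only: sign_power_cancel)
qed

text \<open>
  The one-sided derivatives of order \<open>k - 1\<close> are subgradients, up to sign, of the convex signed
  derivative of order \<open>k - 2\<close>.
\<close>

lemma k_monotone_top_deriv_tendsto: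
  fixes g :: "nat \<Rightarrow> real \<Rightarrow> real"
  assumes k: "2 \<le> k" and g: "\<And>n. k_monotone k (g n)" and g0: "k_monotone k g0"
    and lim: "\<And>x. 0 < x \<Longrightarrow> (\<lambda>n. g n x) \<longlonglongrightarrow> g0 x"
    and x: "0 < x" and diff: "(deriv ^^ (k - 2)) g0 differentiable (at x)"
  shows "(\<lambda>n. left_top_deriv k (g n) x) \<longlonglongrightarrow> (deriv ^^ (k - 1)) g0 x"
    and "(\<lambda>n. right_top_deriv k (g n) x) \<longlonglongrightarrow> (deriv ^^ (k - 1)) g0 x"
proof -
  let ?s = "(-1 :: real) ^ (k - 2)"
  have s: "?s * (?s * r) = r" for r :: real
    by (rule sign_power_cancel)
  have k1: "k - 1 = Suc (k - 2)" using k by simp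
  have "((deriv ^^ (k - 2)) g0 has_real_derivative (deriv ^^ (k - 1)) g0 x) (at x)"
    unfolding k1 using diff by (simp add: DERIV_deriv_iff_real_differentiable)
  then have D0: "(signed_deriv (k - 2) g0 has_real_derivative ?s * (deriv ^^ (k - 1)) g0 x) (at x)"
    by (intro DERIV_cmult)
  have lim': "(\<lambda>n. signed_deriv (k - 2) (g n) y) \<longlonglongrightarrow> signed_deriv (k - 2) g0 y" if "0 < y" for y
    using that by (intro tendsto_mult_left k_monotone_derivs_tendsto[OF g g0 lim]) auto
  note cvx = k_monotone_convex[OF g order.refl]
  have vd: "?s * vector_derivative ((deriv ^^ (k - 2)) (g n)) (at x within S) = d"
    if "at x within S \<noteq> bot" "(signed_deriv (k - 2) (g n) has_real_derivative d) (at x within S)" for S d n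
  proof -
    have "((\<lambda>y. ?s * signed_deriv (k - 2) (g n) y) has_real_derivative ?s * d) (at x within S)"
      using that(2) by (rule DERIV_cmult)
    then have "((deriv ^^ (k - 2)) (g n) has_vector_derivative ?s * d) (at x within S)"
      by (simp add: s has_real_derivative_iff_has_vector_derivative)
    from vector_derivative_within[OF that(1) this] show ?thesis by (simp add: s)
  qed
  have "subgradient_at (signed_deriv (k - 2) (g n)) x (?s * left_top_deriv k (g n) x)" for n
  proof -
    obtain d where d: "(signed_deriv (k - 2) (g n) has_real_derivative d) (at_left x)"
      using convex_has_left_derivative[OF cvx x] by blast
    show ?thesis
      using convex_left_derivative_subgradient[OF cvx x d] vd[OF _ d] by (simp add: left_top_deriv_def)
  qed
  from subgradients_tendsto_derivative[OF lim' x D0 this]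
  have "(\<lambda>n. ?s * (?s * left_top_deriv k (g n) x)) \<longlonglongrightarrow> ?s * (?s * (deriv ^^ (k - 1)) g0 x)"
    by (rule tendsto_mult_left)
  then show "(\<lambda>n. left_top_deriv k (g n) x) \<longlonglongrightarrow> (deriv ^^ (k - 1)) g0 x" by (simp only: s)
  have "subgradient_at (signed_deriv (k - 2) (g n)) x (?s * right_top_deriv k (g n) x)" for n
  proof -
    obtain d where d: "(signed_deriv (k - 2) (g n) has_real_derivative d) (at_right x)"
      using convex_has_right_derivative[OF cvx x] by blast
    show ?thesis
      using convex_right_derivative_subgradient[OF cvx x d] vd[OF _ d] by (simp add: right_top_deriv_def)
  qed
  from subgradients_tendsto_derivative[OF lim' x D0 this]
  have "(\<lambda>n. ?s * (?s * right_top_deriv k (g n) x)) \<longlonglongrightarrow> ?s * (?s * (deriv ^^ (k - 1)) g0 x)"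
    by (rule tendsto_mult_left)
  then show "(\<lambda>n. right_top_deriv k (g n) x) \<longlonglongrightarrow> (deriv ^^ (k - 1)) g0 x" by (simp only: s)
qed

text \<open>
  The nonincreasing signed derivative of order \<open>j\<close> is minus the derivative of a nonnegative
  function, so over \<open>[1, x]\<close> that function loses at least \<open>x - 1\<close> times the value at \<open>x\<close>, yet it
  cannot lose more than its value at 1. The limit is therefore zero.
\<close>

lemma k_monotone_deriv_tail:
  assumes g: "k_monotone k g" and j: "1 \<le> j" "j \<le> k - 2"
  shows "(signed_deriv j g \<longlongrightarrow> 0) at_top"
proof -
  obtain i where i: "j = Suc i" using j by (cases j) auto
  have "signed_deriv j g x \<le> signed_deriv i g 1 / (x - 1)" if x: "1 < x" for x
  proof -
    have hd: "(signed_deriv i g has_real_derivative - signed_deriv j g y) (at y)" if "0 < y" for y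
      using DERIV_cmult[OF k_monotone_has_deriv[OF g _ that, of i], of "(-1) ^ i"] i j by simp
    obtain z where z: "1 < z" "z < x"
      and mvt: "signed_deriv i g x - signed_deriv i g 1 = (x - 1) * - signed_deriv j g z"
      using MVT2[OF x, of "signed_deriv i g" "\<lambda>y. - signed_deriv j g y"] hd by force
    have "signed_deriv j g x \<le> signed_deriv j g z"
      using k_monotone_antimono[OF g j(2), of z x] z x by auto
    then have "(x - 1) * signed_deriv j g x \<le> (x - 1) * signed_deriv j g z"
      by (rule mult_left_mono) (use x in simp)
    also have "\<dots> \<le> signed_deriv i g 1"
      using mvt k_monotone_nonneg[OF g, of i x] i j x by (simp add: algebra_simps)
    finally show ?thesis using x by (simp add: field_simps)
  qed
  then have up: "eventually (\<lambda>x. signed_deriv j g x \<le> signed_deriv i g 1 / (x - 1)) at_top"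
    by (rule eventually_mono[OF eventually_gt_at_top[of 1]])
  have lo: "eventually (\<lambda>x. 0 \<le> signed_deriv j g x) at_top"
    using eventually_gt_at_top[of 0] by eventually_elim (rule k_monotone_nonneg[OF g j(2)])
  have "((\<lambda>x. signed_deriv i g 1 / (x - 1)) \<longlongrightarrow> 0) at_top"
    by (intro tendsto_divide_0[OF tendsto_const] filterlim_at_top_imp_at_infinity
        filterlim_tendsto_add_at_top[OF tendsto_const[of "-1"] filterlim_ident, simplified add.commute, simplified])
  from tendsto_sandwich[OF lo up tendsto_const this] show ?thesis .
qed

text \<open>
  As in Polya's theorem on distribution functions: convergence at the points of a fine finite
  grid controls monotone functions between them, and beyond the last point they are small.
\<close>

lemma antimono_pointwise_imp_uniform:
  fixes F :: "nat \<Rightarrow> real \<Rightarrow> real"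
  assumes F: "\<And>n x y. c \<le> x \<Longrightarrow> x \<le> y \<Longrightarrow> F n y \<le> F n x" and F0: "\<And>n x. c \<le> x \<Longrightarrow> 0 \<le> F n x"
    and G: "\<And>x y. c \<le> x \<Longrightarrow> x \<le> y \<Longrightarrow> G y \<le> G x" and G0: "\<And>x. c \<le> x \<Longrightarrow> 0 \<le> G x"
    and cont: "continuous_on {c..} G" and tail: "(G \<longlongrightarrow> 0) at_top"
    and lim: "\<And>x. c \<le> x \<Longrightarrow> (\<lambda>n. F n x) \<longlonglongrightarrow> G x" and e: "0 < e"
  shows "eventually (\<lambda>n. \<forall>x\<ge>c. \<bar>F n x - G x\<bar> \<le> e) sequentially"
proof -
  have e2: "0 < e / 2" using e by simp
  have "eventually (\<lambda>x. G x < e / 2) at_top" by (rule order_tendstoD(2)[OF tail e2])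
  then have "eventually (\<lambda>x. G x < e / 2 \<and> c < x) at_top"
    using eventually_gt_at_top[of c] by eventually_elim auto
  then obtain A where A: "G A < e / 2" "c < A"
    using eventually_happens'[OF trivial_limit_at_top_linorder] by blast
  have "uniformly_continuous_on {c..A} G"
    using cont by (intro compact_uniformly_continuous) (auto intro: continuous_on_subset)
  then obtain d where d: "0 < d" "\<And>x y. x \<in> {c..A} \<Longrightarrow> y \<in> {c..A} \<Longrightarrow> dist y x < d \<Longrightarrow> dist (G y) (G x) < e / 2"
    using e2 unfolding uniformly_continuous_on_def by metis
  obtain N where N: "(A - c) / d < real N" using reals_Archimedean2 by blast
  have N0: "0 < real N" using N A d by (meson diff_gt_0_iff_gt divide_pos_pos order.strict_trans)
  define h where "h = (A - c) / real N"
  have h: "0 < h" "h < d" "real N * h = A - c" using N A d N0 by (auto simp: h_def field_simps)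
  define t where "t i = c + real i * h" for i
  have t: "c \<le> t i" for i using h by (simp add: t_def)
  have "eventually (\<lambda>n. \<forall>i\<in>{..N}. \<bar>F n (t i) - G (t i)\<bar> < e / 2) sequentially"
    using tendstoD[OF lim[OF t] e2] by (intro eventually_ball_finite) (auto simp: dist_real_def)
  then show ?thesis
  proof (eventually_elim, intro allI impI)
    fix n x assume near: "\<forall>i\<in>{..N}. \<bar>F n (t i) - G (t i)\<bar> < e / 2" and x: "c \<le> x"
    have near': "F n (t i) < G (t i) + e / 2" "G (t i) < F n (t i) + e / 2" if "i \<le> N" for i
    proof -
      have "\<bar>F n (t i) - G (t i)\<bar> < e / 2" using near that by simp
      then show "F n (t i) < G (t i) + e / 2" "G (t i) < F n (t i) + e / 2"
        unfolding abs_diff_less_iff by linarith+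
    qed
    show "\<bar>F n x - G x\<bar> \<le> e"
    proof (cases "x < A")
      case False
      have "t N = A" using h by (simp add: t_def)
      then have "F n x \<le> G A + e / 2" using F[of A x n] near'(1)[of N] A False by simp
      moreover have "G x \<le> G A" using G[of A x] A False by simp
      ultimately show ?thesis using F0[OF x, of n] G0[OF x] A(1) by (simp add: abs_le_iff)
    next
      case True
      define i where "i = nat \<lfloor>(x - c) / h\<rfloor>"
      have "0 \<le> (x - c) / h" using x h by simp
      then have "real i \<le> (x - c) / h" "(x - c) / h < real i + 1" unfolding i_def by linarith+
      then have i: "t i \<le> x" "x < t (Suc i)" using h by (auto simp: t_def field_simps)
      have "(x - c) / h < real N" using True h by (simp add: field_simps)
      then have iN: "Suc i \<le> N" using \<open>real i \<le> (x - c) / h\<close> by linarith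
      have "real (Suc i) * h \<le> real N * h" using iN h by (intro mult_right_mono) simp_all
      then have tA: "t (Suc i) \<le> A" using h(3) unfolding t_def by linarith
      have tt: "t (Suc i) = t i + h" by (simp add: t_def algebra_simps)
      have "\<bar>G (t i) - G x\<bar> < e / 2" "\<bar>G (t (Suc i)) - G x\<bar> < e / 2"
        using d(2)[of x "t i"] d(2)[of x "t (Suc i)"] i tA tt h t[of i] x True by (auto simp: dist_real_def)
      then have "G (t i) < G x + e / 2" "G x < G (t (Suc i)) + e / 2"
        unfolding abs_diff_less_iff by linarith+
      moreover have "F n x \<le> F n (t i)" "F n (t (Suc i)) \<le> F n x" using F i t x by auto
      ultimately have "F n x \<le> G x + e" "G x \<le> F n x + e"
        using near'(1)[of i] near'(2)[of "Suc i"] iN by auto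
      then show ?thesis by (simp add: abs_le_iff)
    qed
  qed
qed

lemma k_monotone_derivs_uniform:
  fixes g :: "nat \<Rightarrow> real \<Rightarrow> real"
  assumes g: "\<And>n. k_monotone k (g n)" and g0: "k_monotone k g0"
    and lim: "\<And>x. 0 < x \<Longrightarrow> (\<lambda>n. g n x) \<longlonglongrightarrow> g0 x"
    and j: "1 \<le> j" "j \<le> k - 2" and c: "0 < c"
  shows "(\<lambda>n. SUP x\<in>{c..}. ereal \<bar>(deriv ^^ j) (g n) x - (deriv ^^ j) g0 x\<bar>) \<longlonglongrightarrow> 0"
proof (rule order_tendstoI)
  fix a :: ereal assume "a < 0"
  moreover have "0 \<le> (SUP x\<in>{c..}. ereal \<bar>(deriv ^^ j) (g n) x - (deriv ^^ j) g0 x\<bar>)" for n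
    by (rule SUP_upper2[of c]) auto
  ultimately show "eventually (\<lambda>n. a < (SUP x\<in>{c..}. ereal \<bar>(deriv ^^ j) (g n) x - (deriv ^^ j) g0 x\<bar>)) sequentially"
    by (intro always_eventually allI) (rule less_le_trans)
next
  fix a :: ereal assume "0 < a"
  then obtain e where e: "0 < ereal e" "ereal e < a" using ereal_dense2 by blast
  have "eventually (\<lambda>n. \<forall>x\<ge>c. \<bar>signed_deriv j (g n) x - signed_deriv j g0 x\<bar> \<le> e) sequentially"
  proof (rule antimono_pointwise_imp_uniform)
    show "continuous_on {c..} (signed_deriv j g0)"
      using convex_on_continuous[OF _ k_monotone_convex[OF g0 j(2)]] c by (auto intro: continuous_on_subset)
    show "(signed_deriv j g0 \<longlongrightarrow> 0) at_top" by (rule k_monotone_deriv_tail[OF g0 j])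
    show "(\<lambda>n. signed_deriv j (g n) x) \<longlonglongrightarrow> signed_deriv j g0 x" if "c \<le> x" for x
      using that c j by (intro tendsto_mult_left k_monotone_derivs_tendsto[OF g g0 lim]) auto
  qed (use c e k_monotone_nonneg[OF g j(2)] k_monotone_nonneg[OF g0 j(2)]
      k_monotone_antimono[OF g j(2)] k_monotone_antimono[OF g0 j(2)] in auto)
  then show "eventually (\<lambda>n. (SUP x\<in>{c..}. ereal \<bar>(deriv ^^ j) (g n) x - (deriv ^^ j) g0 x\<bar>) < a) sequentially"
  proof eventually_elim
    case (elim n)
    have "\<bar>(deriv ^^ j) (g n) x - (deriv ^^ j) g0 x\<bar> = \<bar>signed_deriv j (g n) x - signed_deriv j g0 x\<bar>" for x
      by (simp add: right_diff_distrib[symmetric] abs_mult)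
    then have "(SUP x\<in>{c..}. ereal \<bar>(deriv ^^ j) (g n) x - (deriv ^^ j) g0 x\<bar>) \<le> ereal e"
      using elim by (intro SUP_least) auto
    then show ?case using e(2) by (rule le_less_trans)
  qed
qed

section \<open>From mean-square to pointwise convergence\<close>

lemma set_integral_ge_const:
  fixes h :: "real \<Rightarrow> real"
  assumes int: "set_integrable lborel {0<..} h" and nn: "\<And>y. 0 < y \<Longrightarrow> 0 \<le> h y"
    and ab: "0 \<le> a" "a \<le> b" and c: "\<And>y. a < y \<Longrightarrow> y \<le> b \<Longrightarrow> c \<le> h y"
  shows "c * (b - a) \<le> (LBINT y:{0<..}. h y)"
proof -
  have sub: "{a<..b} \<subseteq> {0<..}" using ab by auto
  have "c * (b - a) = (LBINT y:{a<..b}. c)"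
    unfolding set_lebesgue_integral_def using ab by (simp add: mult.commute[of _ c])
  also have "\<dots> \<le> (LBINT y:{a<..b}. h y)"
    by (intro set_integral_mono set_integrable_subset[OF int])
      (use ab c in \<open>auto simp: set_integrable_def\<close>)
  also have "\<dots> \<le> (LBINT y:{0<..}. h y)"
    unfolding set_lebesgue_integral_def
    by (intro integral_mono)
      (use ab nn set_integrable_subset[OF int _ sub] int in \<open>auto simp: set_integrable_def indicator_def\<close>)
  finally show ?thesis .
qed

text \<open>
  If \<open>F n x\<close> were too large, then by monotonicity \<open>F n\<close> would be too large on an interval to the
  left of \<open>x\<close> whose length depends only on the continuity of \<open>G\<close>; this costs a fixed amount in
  mean square. Values that are too small propagate to the right in the same way.
\<close>

lemma antimono_L2_tendsto_pointwise:
  fixes F :: "nat \<Rightarrow> real \<Rightarrow> real"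
  assumes F: "\<And>n x y. 0 < x \<Longrightarrow> x \<le> y \<Longrightarrow> F n y \<le> F n x" and cont: "continuous_on {0<..} G"
    and int: "\<And>n. set_integrable lborel {0<..} (\<lambda>x. (F n x - G x)\<^sup>2)"
    and L2: "(\<lambda>n. LBINT x:{0<..}. (F n x - G x)\<^sup>2) \<longlonglongrightarrow> 0" and x: "0 < x"
  shows "(\<lambda>n. F n x) \<longlonglongrightarrow> G x"
proof (rule tendstoI)
  fix e :: real assume e: "0 < e"
  have "isCont G x" using cont x by (simp add: continuous_on_eq_continuous_at)
  then obtain d where d: "0 < d" "\<And>y. \<bar>y - x\<bar> < d \<Longrightarrow> \<bar>G y - G x\<bar> < e / 2"
    using e unfolding continuous_at_eps_delta dist_real_def by (metis half_gt_zero)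
  define h where "h = min d x / 2"
  have h: "0 < h" "h < d" "h < x" using d x by (auto simp: h_def)
  have "eventually (\<lambda>n. (LBINT x:{0<..}. (F n x - G x)\<^sup>2) < (e / 2)\<^sup>2 * h) sequentially"
    by (rule order_tendstoD(2)[OF L2]) (use e h in simp)
  then show "eventually (\<lambda>n. dist (F n x) (G x) < e) sequentially"
  proof eventually_elim
    case (elim n)
    have sq: "(e / 2)\<^sup>2 \<le> (r)\<^sup>2" if "e / 2 \<le> \<bar>r\<bar>" for r :: real
      using that e by (metis abs_le_square_iff abs_of_pos half_gt_zero)
    have up: "\<not> G x + e \<le> F n x"
    proof
      assume a: "G x + e \<le> F n x"
      have "(e / 2)\<^sup>2 * (x - (x - h)) \<le> (LBINT y:{0<..}. (F n y - G y)\<^sup>2)"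
      proof (rule set_integral_ge_const[OF int])
        fix y assume y: "x - h < y" "y \<le> x"
        have "F n x \<le> F n y" using F[of y x n] y h by simp
        moreover have "\<bar>G y - G x\<bar> < e / 2" using d(2)[of y] y h by simp
        then have "G x - e / 2 < G y" "G y < G x + e / 2" unfolding abs_diff_less_iff by linarith+
        ultimately have "e / 2 \<le> \<bar>F n y - G y\<bar>" using a by linarith
        then show "(e / 2)\<^sup>2 \<le> (F n y - G y)\<^sup>2" by (rule sq)
      qed (use h in auto)
      then show False using elim by simp
    qed
    have lo: "\<not> F n x \<le> G x - e"
    proof
      assume a: "F n x \<le> G x - e"
      have "(e / 2)\<^sup>2 * (x + h - x) \<le> (LBINT y:{0<..}. (F n y - G y)\<^sup>2)"
      proof (rule set_integral_ge_const[OF int])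
        fix y assume y: "x < y" "y \<le> x + h"
        have "F n y \<le> F n x" using F[of x y n] y x by simp
        moreover have "\<bar>G y - G x\<bar> < e / 2" using d(2)[of y] y h by simp
        then have "G x - e / 2 < G y" "G y < G x + e / 2" unfolding abs_diff_less_iff by linarith+
        ultimately have "e / 2 \<le> \<bar>F n y - G y\<bar>" using a by linarith
        then show "(e / 2)\<^sup>2 \<le> (F n y - G y)\<^sup>2" by (rule sq)
      qed (use h x in auto)
      then show False using elim by simp
    qed
    from up lo show ?case by (simp add: dist_real_def abs_diff_less_iff)
  qed
qed

section \<open>The variational inequality of the least squares estimator\<close>

lemma k_monotone_base:
  assumes "k_monotone k g"
  shows k_monotone_fun_nonneg: "0 < x \<Longrightarrow> 0 \<le> g x"
    and k_monotone_fun_antimono: "0 < x \<Longrightarrow> x \<le> y \<Longrightarrow> g y \<le> g x"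
    and k_monotone_fun_continuous: "continuous_on {0<..} g"
  using k_monotone_nonneg[OF assms, of 0 x] k_monotone_antimono[OF assms, of 0 x y]
    convex_on_continuous[OF _ k_monotone_convex[OF assms, of 0]] by auto

lemma higher_deriv_lincomb:
  assumes g: "k_monotone k g" and h: "k_monotone k h"
  shows "l \<le> k - 2 \<Longrightarrow> 0 < x \<Longrightarrow>
    (deriv ^^ l) (\<lambda>x. a * g x + b * h x) x = a * (deriv ^^ l) g x + b * (deriv ^^ l) h x"
proof (induction l arbitrary: x)
  case (Suc l)
  have "((\<lambda>x. a * (deriv ^^ l) g x + b * (deriv ^^ l) h x) has_real_derivative
      a * (deriv ^^ Suc l) g x + b * (deriv ^^ Suc l) h x) (at x)"
    using Suc.prems k_monotone_has_deriv[OF g, of l x] k_monotone_has_deriv[OF h, of l x]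
    by (intro DERIV_add DERIV_cmult) auto
  then have "((deriv ^^ l) (\<lambda>x. a * g x + b * h x) has_real_derivative
      a * (deriv ^^ Suc l) g x + b * (deriv ^^ Suc l) h x) (at x)"
    by (rule has_field_derivative_transform_within_open[where S = "{0<..}"])
      (use Suc in auto)
  then show ?case by (simp add: DERIV_imp_deriv)
qed simp

lemma convex_on_cong_on:
  assumes "convex_on S f" and "\<And>x. x \<in> S \<Longrightarrow> f x = g x"
  shows "convex_on S g"
proof -
  have S: "u *\<^sub>R x + v *\<^sub>R y \<in> S" if "x \<in> S" "y \<in> S" "0 \<le> u" "0 \<le> v" "u + v = 1" for x y u v
    using convexD[OF convex_on_imp_convex[OF assms(1)]] that by blast
  have "g (u *\<^sub>R x + v *\<^sub>R y) \<le> u * g x + v * g y"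
    if *: "x \<in> S" "y \<in> S" "0 \<le> u" "0 \<le> v" "u + v = 1" for x y u v
  proof -
    have "f (u *\<^sub>R x + v *\<^sub>R y) \<le> u * f x + v * f y"
      using assms(1) * unfolding convex_on_def by blast
    then show ?thesis using assms(2) S[OF *] * by metis
  qed
  then show ?thesis using convex_on_imp_convex[OF assms(1)] unfolding convex_on_def by blast
qed

lemma k_monotone_lincomb:
  assumes g: "k_monotone k g" and h: "k_monotone k h" and ab: "0 \<le> a" "0 \<le> b"
  shows "k_monotone k (\<lambda>x. a * g x + b * h x)"
proof -
  let ?f = "\<lambda>x. a * g x + b * h x"
  note eq = higher_deriv_lincomb[OF g h, of _ _ a b]
  have sd: "signed_deriv l ?f x = a * signed_deriv l g x + b * signed_deriv l h x"
    if "l \<le> k - 2" "0 < x" for l x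
    using eq[OF that] by (simp add: algebra_simps)
  have "(deriv ^^ l) ?f differentiable (at x)" if l: "l < k - 2" and x: "0 < x" for l x
  proof -
    have "((\<lambda>x. a * (deriv ^^ l) g x + b * (deriv ^^ l) h x) has_real_derivative
        a * (deriv ^^ Suc l) g x + b * (deriv ^^ Suc l) h x) (at x)"
      using k_monotone_has_deriv[OF g l x] k_monotone_has_deriv[OF h l x]
      by (intro DERIV_add DERIV_cmult)
    then have "((deriv ^^ l) ?f has_real_derivative
        a * (deriv ^^ Suc l) g x + b * (deriv ^^ Suc l) h x) (at x)"
      by (rule has_field_derivative_transform_within_open[where S = "{0<..}"])
        (use eq l x in auto)
    then show ?thesis using real_differentiable_def by blast
  qed
  moreover have "0 \<le> signed_deriv l ?f x" if "l \<le> k - 2" "0 < x" for l x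
    using ab k_monotone_nonneg[OF g that] k_monotone_nonneg[OF h that] by (simp add: sd[OF that])
  moreover have "antimono_on {0<..} (signed_deriv l ?f)" if l: "l \<le> k - 2" for l
    using add_mono[OF mult_left_mono[OF k_monotone_antimono[OF g l] ab(1)]
        mult_left_mono[OF k_monotone_antimono[OF h l] ab(2)]]
    by (simp add: monotone_on_def sd[OF l])
  moreover have "convex_on {0<..} (signed_deriv l ?f)" if l: "l \<le> k - 2" for l
  proof (rule convex_on_cong_on)
    show "convex_on {0<..} (\<lambda>x. a * signed_deriv l g x + b * signed_deriv l h x)"
      by (rule convex_on_add[OF convex_on_cmul[OF ab(1) k_monotone_convex[OF g l]]
            convex_on_cmul[OF ab(2) k_monotone_convex[OF h l]]])
  qed (simp add: sd[OF l])
  ultimately show ?thesis unfolding k_monotone_def by blast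
qed

lemma k_monotone_zero: "k_monotone k (\<lambda>_. 0)"
proof -
  have "(deriv ^^ l) (\<lambda>_::real. 0::real) = (\<lambda>_. 0)" for l
    by (induction l) auto
  then show ?thesis by (simp add: k_monotone_def monotone_on_def convex_on_const)
qed

lemma square_integrable_mult:
  assumes f: "square_integrable f" and h: "square_integrable h"
  shows "set_integrable lborel {0<..} (\<lambda>x. f x * h x)"
  unfolding set_integrable_def
proof (rule Bochner_Integration.integrable_bound)
  let ?i = "indicator {0<..} :: real \<Rightarrow> real"
  show "integrable lborel (\<lambda>x. ?i x *\<^sub>R (f x)\<^sup>2 + ?i x *\<^sub>R (h x)\<^sup>2)"
    using f h by (intro Bochner_Integration.integrable_add) (auto simp: square_integrable_def set_integrable_def)
  have m: "(\<lambda>x. ?i x *\<^sub>R f x) \<in> borel_measurable lborel" "(\<lambda>x. ?i x *\<^sub>R h x) \<in> borel_measurable lborel"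
    using f h by (auto simp: square_integrable_def set_borel_measurable_def)
  have "(\<lambda>x. ?i x *\<^sub>R (f x * h x)) = (\<lambda>x. (?i x *\<^sub>R f x) * (?i x *\<^sub>R h x))"
    by (auto simp: indicator_def)
  then show "(\<lambda>x. ?i x *\<^sub>R (f x * h x)) \<in> borel_measurable lborel"
    using borel_measurable_times[OF m] by simp
  have "\<bar>f x * h x\<bar> \<le> (f x)\<^sup>2 + (h x)\<^sup>2" for x
  proof -
    have "0 \<le> (\<bar>f x\<bar> - \<bar>h x\<bar>)\<^sup>2" by simp
    then have "2 * \<bar>f x * h x\<bar> \<le> (f x)\<^sup>2 + (h x)\<^sup>2" by (simp add: power2_diff abs_mult)
    then show ?thesis by linarith
  qed
  then show "AE x in lborel. norm (?i x *\<^sub>R (f x * h x)) \<le> norm (?i x *\<^sub>R (f x)\<^sup>2 + ?i x *\<^sub>R (h x)\<^sup>2)"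
    by (auto simp: indicator_def)
qed

lemma square_integrable_lincomb:
  assumes f: "square_integrable f" and h: "square_integrable h"
  shows "square_integrable (\<lambda>x. a * f x + b * h x)"
  unfolding square_integrable_def
proof
  let ?i = "indicator {0<..} :: real \<Rightarrow> real"
  have m: "(\<lambda>x. ?i x *\<^sub>R f x) \<in> borel_measurable lborel" "(\<lambda>x. ?i x *\<^sub>R h x) \<in> borel_measurable lborel"
    using f h by (auto simp: square_integrable_def set_borel_measurable_def)
  have "(\<lambda>x. ?i x *\<^sub>R (a * f x + b * h x)) = (\<lambda>x. a * (?i x *\<^sub>R f x) + b * (?i x *\<^sub>R h x))"
    by (auto simp: algebra_simps)
  then show "set_borel_measurable lborel {0<..} (\<lambda>x. a * f x + b * h x)"
    unfolding set_borel_measurable_def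
    using borel_measurable_add[OF borel_measurable_times[OF borel_measurable_const m(1)]
        borel_measurable_times[OF borel_measurable_const m(2)]] by simp
  have "(\<lambda>x. (a * f x + b * h x)\<^sup>2) = (\<lambda>x. a\<^sup>2 * (f x * f x) + (2 * a * b) * (f x * h x) + b\<^sup>2 * (h x * h x))"
    by (auto simp: power2_sum power_mult_distrib power2_eq_square algebra_simps)
  then show "set_integrable lborel {0<..} (\<lambda>x. (a * f x + b * h x)\<^sup>2)"
    using square_integrable_mult[OF f f] square_integrable_mult[OF f h] square_integrable_mult[OF h h]
    by (simp add: set_integral_add)
qed

definition inner_L2 :: "(real \<Rightarrow> real) \<Rightarrow> (real \<Rightarrow> real) \<Rightarrow> real" where
  "inner_L2 f h = (LBINT x:{0<..}. f x * h x)"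

lemma inner_L2_commute: "inner_L2 f h = inner_L2 h f"
  by (simp add: inner_L2_def mult.commute)

lemma inner_L2_lincomb:
  assumes "square_integrable f" "square_integrable h" "square_integrable u"
  shows "inner_L2 (\<lambda>x. a * f x + b * h x) u = a * inner_L2 f u + b * inner_L2 h u"
proof -
  have "(\<lambda>x. (a * f x + b * h x) * u x) = (\<lambda>x. a * (f x * u x) + b * (h x * u x))"
    by (auto simp: algebra_simps)
  then show ?thesis
    using square_integrable_mult[OF assms(1,3)] square_integrable_mult[OF assms(2,3)]
    by (simp add: inner_L2_def set_integral_add)
qed

lemma inner_L2_self_nonneg: "0 \<le> inner_L2 f f"
  by (simp add: inner_L2_def set_lebesgue_integral_def)

lemma ls_criterion_alt: "ls_criterion n xs g = inner_L2 g g / 2 - emp_mean n xs g"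
  by (simp add: ls_criterion_def inner_L2_def emp_mean_def power2_eq_square)

text \<open>
  Moving from \<open>g\<close> towards \<open>h\<close> stays in the convex cone, so the directional derivative of the
  criterion at its minimizer is nonnegative.
\<close>

lemma lse_variational_inequality:
  assumes lse: "is_lse k n xs g" and h: "k_monotone k h" "square_integrable h"
  shows "emp_mean n xs h - emp_mean n xs g \<le> inner_L2 g h - inner_L2 g g"
proof (rule ccontr)
  assume neg: "\<not> ?thesis"
  have g: "k_monotone k g" "square_integrable g"
    and min: "\<And>f. k_monotone k f \<Longrightarrow> square_integrable f \<Longrightarrow> ls_criterion n xs g \<le> ls_criterion n xs f"
    using lse by (auto simp: is_lse_def)
  define A where "A = inner_L2 g h - inner_L2 g g - (emp_mean n xs h - emp_mean n xs g)"
  define B where "B = inner_L2 g g - 2 * inner_L2 g h + inner_L2 h h"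
  have A: "A < 0" using neg by (simp add: A_def)
  have step: "0 \<le> A + t * (B / 2)" if t: "0 < t" "t \<le> 1" for t
  proof -
    let ?f = "\<lambda>x. (1 - t) * g x + t * h x"
    have f: "square_integrable ?f" by (intro square_integrable_lincomb g h)
    have le: "ls_criterion n xs g \<le> ls_criterion n xs ?f"
      using t by (intro min f k_monotone_lincomb g h) auto
    have ff: "inner_L2 ?f ?f = (1 - t) * inner_L2 ?f g + t * inner_L2 ?f h"
      using inner_L2_lincomb[OF g(2) h(2) f, of "1 - t" t] by (simp only: inner_L2_commute[of g ?f] inner_L2_commute[of h ?f])
    have fg: "inner_L2 ?f g = (1 - t) * inner_L2 g g + t * inner_L2 g h"
      using inner_L2_lincomb[OF g(2) h(2) g(2), of "1 - t" t] by (simp add: inner_L2_commute[of h g])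
    have fh: "inner_L2 ?f h = (1 - t) * inner_L2 g h + t * inner_L2 h h"
      using inner_L2_lincomb[OF g(2) h(2) h(2), of "1 - t" t] by simp
    have ef: "emp_mean n xs ?f = (1 - t) * emp_mean n xs g + t * emp_mean n xs h"
      by (simp add: emp_mean_add emp_mean_cmult)
    have "ls_criterion n xs ?f - ls_criterion n xs g = t * (A + t * (B / 2))"
      unfolding ls_criterion_alt ff fg fh ef A_def B_def
      by (simp add: add_divide_distrib diff_divide_distrib algebra_simps)
    with le have "0 \<le> t * (A + t * (B / 2))" by linarith
    then show ?thesis using t by (simp add: zero_le_mult_iff)
  qed
  define m where "m = \<bar>B\<bar> + 1"
  have m: "0 < m" "B \<le> m" by (auto simp: m_def)
  \<comment> \<open>A step this short keeps the quadratic term below half of the linear decrease.\<close>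
  define t where "t = min 1 (- A / m)"
  have "0 < - A / m" using A m by (intro divide_pos_pos) auto
  then have t: "0 < t" "t \<le> 1" "t \<le> - A / m" by (auto simp: t_def)
  have "t * (B / 2) \<le> t * (m / 2)" using t m by (intro mult_left_mono) auto
  also have "\<dots> \<le> (- A / m) * (m / 2)" using t m by (intro mult_right_mono) auto
  also have "\<dots> = - A / 2" using m by simp
  finally show False using step[OF t(1,2)] A by linarith
qed

lemma square_integrable_zero: "square_integrable (\<lambda>_. 0)"
  by (simp add: square_integrable_def set_borel_measurable_def set_integrable_def)

lemma powr_minus_half:
  assumes "0 < x"
  shows "x powr (- 1 / 2) = 1 / sqrt x"
proof -
  have "x powr (- (1 / 2)) = 1 / sqrt x"
    unfolding powr_minus using assms by (simp add: powr_half_sqrt inverse_eq_divide)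
  then show ?thesis by simp
qed

text \<open>
  By monotonicity \<open>(g x)\<^sup>2\<close> is a lower bound for the integrand on \<open>(0, x]\<close>.
\<close>

lemma k_monotone_L2_pointwise_bound:
  assumes g: "k_monotone k g" "square_integrable g" and x: "0 < x"
  shows "g x \<le> sqrt (inner_L2 g g) * x powr (- 1 / 2)"
proof -
  have "(g x)\<^sup>2 * (x - 0) \<le> (LBINT y:{0<..}. (g y)\<^sup>2)"
  proof (rule set_integral_ge_const)
    show "(g x)\<^sup>2 \<le> (g y)\<^sup>2" if "0 < y" "y \<le> x" for y
      using k_monotone_fun_antimono[OF g(1) that] k_monotone_fun_nonneg[OF g(1) x] by (intro power_mono)
  qed (use g x in \<open>auto simp: square_integrable_def\<close>)
  then have "(g x)\<^sup>2 * x \<le> inner_L2 g g" by (simp add: inner_L2_def power2_eq_square)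
  then have "sqrt ((g x)\<^sup>2 * x) \<le> sqrt (inner_L2 g g)" by simp
  then have "g x * sqrt x \<le> sqrt (inner_L2 g g)"
    using k_monotone_fun_nonneg[OF g(1) x] by (simp add: real_sqrt_mult)
  then show ?thesis unfolding powr_minus_half[OF x] using x by (simp add: pos_le_divide_eq)
qed

text \<open>
  Comparing with the zero function gives \<open>\<langle>g, g\<rangle> \<le> E\<^sub>n g\<close>, and the pointwise bound on \<open>g\<close> turns
  the right-hand side into its norm times the stated average.
\<close>

lemma lse_norm_bound:
  assumes lse: "is_lse k n xs g" and xs: "\<And>i. 1 \<le> i \<Longrightarrow> 0 < xs i"
  shows "sqrt (inner_L2 g g) \<le> emp_mean n xs (\<lambda>x. x powr (- 1 / 2))"
proof -
  let ?N = "sqrt (inner_L2 g g)" and ?E = "emp_mean n xs (\<lambda>x. x powr (- 1 / 2))"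
  have g: "k_monotone k g" "square_integrable g" using lse by (auto simp: is_lse_def)
  have "inner_L2 g g \<le> emp_mean n xs g"
    using lse_variational_inequality[OF lse k_monotone_zero square_integrable_zero]
    by (simp add: inner_L2_def emp_mean_def)
  also have "\<dots> \<le> emp_mean n xs (\<lambda>x. ?N * x powr (- 1 / 2))"
    by (intro emp_mean_mono k_monotone_L2_pointwise_bound[OF g] xs)
  also have "\<dots> = ?N * ?E" by (rule emp_mean_cmult)
  finally have le: "?N * ?N \<le> ?N * ?E" using inner_L2_self_nonneg[of g] by simp
  have E0: "0 \<le> ?E" by (simp add: emp_mean_def sum_nonneg)
  show ?thesis
  proof (cases "?N = 0")
    case False
    then have "0 < ?N" using inner_L2_self_nonneg[of g] by (metis antisym_conv2 real_sqrt_ge_zero)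
    then show ?thesis using le by (metis mult_le_cancel_left_pos)
  qed (use E0 in simp)
qed

text \<open>
  The expanded square contains \<open>\<langle>g, g\<rangle> - \<langle>g, g0\<rangle>\<close>, which the variational inequality at \<open>h = g0\<close>
  bounds by a difference of sample averages.
\<close>

lemma lse_L2_error_bound:
  assumes lse: "is_lse k n xs g" and g0: "k_monotone k g0" "square_integrable g0"
  shows "(LBINT x:{0<..}. (g x - g0 x)\<^sup>2) \<le>
    (emp_mean n xs g - inner_L2 g g0) + (inner_L2 g0 g0 - emp_mean n xs g0)"
proof -
  have g: "square_integrable g" using lse by (auto simp: is_lse_def)
  let ?d = "\<lambda>x. 1 * g x + (- 1) * g0 x"
  have d: "square_integrable ?d" by (intro square_integrable_lincomb g g0)
  have "(LBINT x:{0<..}. (g x - g0 x)\<^sup>2) = inner_L2 ?d ?d"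
    by (simp add: inner_L2_def power2_eq_square)
  also have "\<dots> = inner_L2 g g - 2 * inner_L2 g g0 + inner_L2 g0 g0"
    using inner_L2_lincomb[OF g g0(2) d, of 1 "-1"] inner_L2_lincomb[OF g g0(2) g, of 1 "-1"]
      inner_L2_lincomb[OF g g0(2) g0(2), of 1 "-1"]
      inner_L2_commute[of g ?d] inner_L2_commute[of g0 ?d] inner_L2_commute[of g0 g] by linarith
  finally show ?thesis using lse_variational_inequality[OF lse g0] by simp
qed

section \<open>Bracketing monotone functions on a grid\<close>

lemma step_function_above:
  fixes g :: "real \<Rightarrow> real" and t :: "nat \<Rightarrow> real"
  assumes g: "\<And>x y. 0 < x \<Longrightarrow> x \<le> y \<Longrightarrow> g y \<le> g x" and g0: "\<And>x. 0 < x \<Longrightarrow> 0 \<le> g x"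
    and t0: "0 < t 0" and t: "mono t"
  shows "t 0 < x \<Longrightarrow> x \<le> t N \<Longrightarrow> g x \<le> (\<Sum>j<N. g (t j) * indicator {t j<..t (Suc j)} x)"
proof (induction N)
  case (Suc N)
  have tpos: "0 < t j" for j using t0 monoD[OF t, of 0 j] by simp
  have nn: "0 \<le> (\<Sum>j<N. g (t j) * indicator {t j<..t (Suc j)} x)"
    using g0[OF tpos] by (intro sum_nonneg) auto
  show ?case
  proof (cases "x \<le> t N")
    case True
    then show ?thesis using Suc g0[OF tpos[of N]] by (auto intro: order_trans[OF Suc.IH])
  next
    case False
    then have "g x \<le> g (t N) * indicator {t N<..t (Suc N)} x"
      using Suc.prems g[OF tpos, of N x] by simp
    then show ?thesis using nn by simp
  qed
qed simp

text \<open>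
  The cells are disjoint: when \<open>x\<close> lies in the last cell all earlier terms vanish.
\<close>

lemma step_function_below:
  fixes g :: "real \<Rightarrow> real" and t :: "nat \<Rightarrow> real"
  assumes g: "\<And>x y. 0 < x \<Longrightarrow> x \<le> y \<Longrightarrow> g y \<le> g x" and g0: "0 \<le> g x"
    and t: "mono t" and x: "0 < x"
  shows "(\<Sum>j<N. g (t (Suc j)) * indicator {t j<..t (Suc j)} x) \<le> g x"
proof (induction N)
  case 0
  then show ?case using g0 by simp
next
  case (Suc N)
  show ?case
  proof (cases "t N < x \<and> x \<le> t (Suc N)")
    case True
    have "(\<Sum>j<N. g (t (Suc j)) * indicator {t j<..t (Suc j)} x) = 0"
    proof (intro sum.neutral ballI)
      fix j assume "j \<in> {..<N}"
      then have "t (Suc j) \<le> t N" by (intro monoD[OF t]) auto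
      then show "g (t (Suc j)) * indicator {t j<..t (Suc j)} x = 0" using True by simp
    qed
    then show ?thesis using True g[OF x, of "t (Suc N)"] by simp
  next
    case False
    then show ?thesis using Suc by (auto simp: indicator_def)
  qed
qed

definition cell_mass :: "(real \<Rightarrow> real) \<Rightarrow> real \<Rightarrow> real \<Rightarrow> real" where
  "cell_mass g0 s t = (LBINT x:{0<..}. indicator {s<..t} x * g0 x)"

lemma set_integrable_indicator_mult:
  fixes f :: "real \<Rightarrow> real"
  assumes f: "set_integrable lborel {0<..} f" and A: "A \<in> sets borel"
  shows "set_integrable lborel {0<..} (\<lambda>x. indicator A x * f x)"
proof -
  have "integrable lborel (\<lambda>x. indicator A x *\<^sub>R (indicator {0<..} x *\<^sub>R f x))"
    using integrable_mult_indicator[of A lborel "\<lambda>x. indicator {0<..} x *\<^sub>R f x"] f A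
    by (simp only: set_integrable_def sets_lborel)
  moreover have "(\<lambda>x. indicator A x *\<^sub>R (indicator {0<..} x *\<^sub>R f x))
      = (\<lambda>x. indicator {0<..} x *\<^sub>R (indicator A x * f x))"
    by (auto simp: indicator_def)
  ultimately show ?thesis by (simp only: set_integrable_def)
qed

lemma cell_mass_bounds:
  assumes g0: "k_monotone k g0" and int: "set_integrable lborel {0<..} g0" and s: "0 < d" "d \<le> s" "s \<le> t"
  shows "0 \<le> cell_mass g0 s t" and "cell_mass g0 s t \<le> g0 d * (t - s)"
proof -
  show "0 \<le> cell_mass g0 s t"
    unfolding cell_mass_def set_lebesgue_integral_def
    by (intro integral_nonneg_AE AE_I2) (auto simp: indicator_def k_monotone_fun_nonneg[OF g0])
  have "cell_mass g0 s t \<le> (\<integral>x. g0 d * indicator {s<..t} x \<partial>lborel)"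
    unfolding cell_mass_def set_lebesgue_integral_def
  proof (rule integral_mono)
    show "integrable lborel (\<lambda>x. indicator {0<..} x *\<^sub>R (indicator {s<..t} x * g0 x))"
      using set_integrable_indicator_mult[OF int, of "{s<..t}"] by (simp add: set_integrable_def)
    show "integrable lborel (\<lambda>x. g0 d * indicator {s<..t} x)" using s by simp
    show "indicator {0<..} x *\<^sub>R (indicator {s<..t} x * g0 x) \<le> g0 d * indicator {s<..t} x" for x
      using s k_monotone_fun_antimono[OF g0 s(1), of x] by (auto simp: indicator_def)
  qed
  also have "\<dots> = g0 d * (t - s)" using s by simp
  finally show "cell_mass g0 s t \<le> g0 d * (t - s)" .
qed

text \<open>
  From above, \<open>g\<close> is bounded by the envelope near zero, by its values at left end points on the
  cells, and by \<open>C / sqrt (t N)\<close> beyond the grid; from below, by its values at right end points.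
  The gap between the two step functions telescopes to at most \<open>g d\<close>, multiplied by a bound on
  the mass of a cell. None of the four terms depends on \<open>g\<close> other than through \<open>C\<close>.
\<close>

lemma bracketing_bound:
  assumes g: "k_monotone k g" and bound: "\<And>x. 0 < x \<Longrightarrow> g x \<le> C * x powr (- 1 / 2)" and C: "0 \<le> C"
    and g0: "k_monotone k g0" and int0: "set_integrable lborel {0<..} g0"
    and int: "set_integrable lborel {0<..} (\<lambda>x. g x * g0 x)"
    and xs: "\<And>i. 1 \<le> i \<Longrightarrow> 0 < xs i" and n: "0 < n" and d: "0 < d" and h: "0 < h"
  defines "t \<equiv> \<lambda>j. d + real j * h"
  shows "emp_mean n xs g - inner_L2 g g0
    \<le> C * emp_mean n xs (\<lambda>x. x powr (- 1 / 2) * indicator {..d} x) + C / sqrt (t N)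
      + C / sqrt d * (\<Sum>j<N. \<bar>emp_mean n xs (indicator {t j<..t (Suc j)}) - cell_mass g0 (t j) (t (Suc j))\<bar>)
      + C / sqrt d * (g0 d * h)"
proof -
  let ?\<psi> = "\<lambda>x::real. x powr (- 1 / 2) * indicator {..d} x"
  let ?e = "\<lambda>j. emp_mean n xs (indicator {t j<..t (Suc j)})" and ?p = "\<lambda>j. cell_mass g0 (t j) (t (Suc j))"
  let ?K = "C / sqrt d" and ?P = "g0 d * h"
  have t0: "t 0 = d" by (simp add: t_def)
  have tm: "mono t" using h by (auto simp: t_def mono_def)
  have td: "d \<le> t j" for j using h by (simp add: t_def)
  have tpos: "0 < t j" for j using td[of j] d by linarith
  have tS: "t j \<le> t (Suc j)" for j using monoD[OF tm, of j "Suc j"] by simp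
  have th: "t (Suc j) - t j = h" for j by (simp add: t_def algebra_simps)
  note gm = k_monotone_fun_antimono[OF g] and gnn = k_monotone_fun_nonneg[OF g]
  have gd: "g d \<le> ?K" using bound[OF d] unfolding powr_minus_half[OF d] by simp
  have gK: "g (t j) \<le> ?K" for j using gm[OF d td[of j]] gd by linarith
  have up: "emp_mean n xs g \<le> C * emp_mean n xs ?\<psi> + (\<Sum>j<N. g (t j) * ?e j) + C / sqrt (t N)"
  proof -
    have "emp_mean n xs g \<le> emp_mean n xs
        (\<lambda>x. (C * ?\<psi> x + (\<Sum>j<N. g (t j) * indicator {t j<..t (Suc j)} x)) + C / sqrt (t N))"
    proof (rule emp_mean_mono)
      fix i :: nat assume "1 \<le> i"
      define x where "x = xs i"
      have x: "0 < x" using xs[OF \<open>1 \<le> i\<close>] by (simp add: x_def)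
      have nn: "0 \<le> (\<Sum>j<N. g (t j) * indicator {t j<..t (Suc j)} x)"
        using gnn[OF tpos] by (intro sum_nonneg) auto
      have nn': "0 \<le> C * ?\<psi> x" "0 \<le> C / sqrt (t N)" using C tpos[of N] by auto
      consider "x \<le> d" | "d < x" "x \<le> t N" | "t N < x" by linarith
      then have "g x \<le> (C * ?\<psi> x + (\<Sum>j<N. g (t j) * indicator {t j<..t (Suc j)} x)) + C / sqrt (t N)"
      proof cases
        case 1
        then have "g x \<le> C * ?\<psi> x" using bound[OF x] by simp
        then show ?thesis using nn nn' by linarith
      next
        case 2
        then have "g x \<le> (\<Sum>j<N. g (t j) * indicator {t j<..t (Suc j)} x)"
          by (intro step_function_above[of g t x N, OF gm gnn]) (use tm d t0 in simp_all)
        then show ?thesis using nn' by linarith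
      next
        case 3
        have "g x \<le> g (t N)" using gm[OF tpos, of N x] 3 by simp
        also have "\<dots> \<le> C / sqrt (t N)" using bound[OF tpos, of N] unfolding powr_minus_half[OF tpos] by simp
        finally show ?thesis using nn nn' by linarith
      qed
      then show "g (xs i) \<le> (C * ?\<psi> (xs i) + (\<Sum>j<N. g (t j) * indicator {t j<..t (Suc j)} (xs i))) + C / sqrt (t N)"
        by (simp only: x_def)
    qed
    then show ?thesis using n by (simp only: emp_mean_add emp_mean_cmult emp_mean_sum emp_mean_const)
  qed
  have lo: "(\<Sum>j<N. g (t (Suc j)) * ?p j) \<le> inner_L2 g g0"
  proof -
    define c where "c j x = indicator {0<..} x *\<^sub>R (indicator {t j<..t (Suc j)} x * g0 x)" for j and x :: real
    have cell: "integrable lborel (c j)" for j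
      using set_integrable_indicator_mult[OF int0, of "{t j<..t (Suc j)}"]
      by (simp add: set_integrable_def c_def[abs_def])
    have p: "?p j = integral\<^sup>L lborel (c j)" for j
      by (simp add: cell_mass_def set_lebesgue_integral_def c_def[abs_def])
    have "(\<Sum>j<N. g (t (Suc j)) * ?p j) = (\<integral>x. (\<Sum>j<N. g (t (Suc j)) * c j x) \<partial>lborel)"
      using cell by (simp add: p)
    also have "\<dots> \<le> inner_L2 g g0"
      unfolding inner_L2_def set_lebesgue_integral_def
    proof (rule integral_mono)
      show "integrable lborel (\<lambda>x. \<Sum>j<N. g (t (Suc j)) * c j x)"
        by (intro Bochner_Integration.integrable_sum integrable_mult_right cell)
      show "integrable lborel (\<lambda>x. indicator {0<..} x *\<^sub>R (g x * g0 x))"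
        using int by (simp add: set_integrable_def)
      fix x :: real
      show "(\<Sum>j<N. g (t (Suc j)) * c j x) \<le> indicator {0<..} x *\<^sub>R (g x * g0 x)"
      proof (cases "0 < x")
        case True
        then have "c j x = indicator {t j<..t (Suc j)} x * g0 x" for j by (simp add: c_def)
        then have "(\<Sum>j<N. g (t (Suc j)) * c j x)
            = (\<Sum>j<N. g (t (Suc j)) * indicator {t j<..t (Suc j)} x) * g0 x"
          by (simp only: sum_distrib_right mult.assoc)
        also have "\<dots> \<le> g x * g0 x"
          by (intro mult_right_mono step_function_below[of g x t N, OF gm gnn[OF True] tm True]
              k_monotone_fun_nonneg[OF g0 True])
        finally show ?thesis using True by simp
      qed (simp add: c_def)
    qed
    finally show ?thesis .
  qed
  have cell: "g (t j) * ?e j - g (t (Suc j)) * ?p j \<le> ?K * \<bar>?e j - ?p j\<bar> + (g (t j) - g (t (Suc j))) * ?P" for j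
  proof -
    have "g (t j) * (?e j - ?p j) \<le> g (t j) * \<bar>?e j - ?p j\<bar>"
      using gnn[OF tpos] by (intro mult_left_mono) auto
    also have "\<dots> \<le> ?K * \<bar>?e j - ?p j\<bar>" by (intro mult_right_mono gK) auto
    finally have "g (t j) * (?e j - ?p j) \<le> ?K * \<bar>?e j - ?p j\<bar>" .
    moreover have "(g (t j) - g (t (Suc j))) * ?p j \<le> (g (t j) - g (t (Suc j))) * ?P"
      using cell_mass_bounds(2)[OF g0 int0 d td[of j] tS[of j]] gm[OF tpos tS, of j]
      by (intro mult_left_mono) (auto simp: th)
    ultimately show ?thesis by (simp add: algebra_simps)
  qed
  have "(\<Sum>j<N. g (t j) * ?e j) - (\<Sum>j<N. g (t (Suc j)) * ?p j)
      \<le> (\<Sum>j<N. ?K * \<bar>?e j - ?p j\<bar> + (g (t j) - g (t (Suc j))) * ?P)"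
    unfolding sum_subtractf[symmetric] by (intro sum_mono cell)
  also have "\<dots> = ?K * (\<Sum>j<N. \<bar>?e j - ?p j\<bar>) + (g (t 0) - g (t N)) * ?P"
    by (simp only: sum.distrib sum_distrib_left[symmetric] sum_distrib_right[symmetric]
        sum_lessThan_telescope'[of "\<lambda>j. g (t j)" N])
  also have "(g (t 0) - g (t N)) * ?P \<le> ?K * ?P"
    using gK[of 0] gnn[OF tpos, of N] k_monotone_fun_nonneg[OF g0 d] h by (intro mult_right_mono) auto
  finally show ?thesis using up lo by linarith
qed

lemma truncated_moment_tendsto_0:
  fixes f :: "real \<Rightarrow> real"
  assumes int: "set_integrable lborel {0<..} f"
  shows "(\<lambda>m. LBINT x:{0<..}. indicator {..1 / real (Suc m)} x * f x) \<longlonglongrightarrow> 0"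
proof -
  let ?s = "\<lambda>m x. indicator {0<..} x *\<^sub>R (indicator {..1 / real (Suc m)} x * f x)"
  have "(\<lambda>m. \<integral>x. ?s m x \<partial>lborel) \<longlonglongrightarrow> (\<integral>x. 0 \<partial>(lborel :: real measure))"
  proof (rule integral_dominated_convergence[where w = "\<lambda>x. \<bar>indicator {0<..} x *\<^sub>R f x\<bar>"])
    show "integrable lborel (\<lambda>x. \<bar>indicator {0<..} x *\<^sub>R f x\<bar>)"
      using int unfolding set_integrable_def by (rule integrable_abs)
    show "?s m \<in> borel_measurable lborel" for m
      using set_integrable_indicator_mult[OF int, of "{..1 / real (Suc m)}"]
      unfolding set_integrable_def by (intro borel_measurable_integrable) simp
    show "AE x in lborel. norm (?s m x) \<le> \<bar>indicator {0<..} x *\<^sub>R f x\<bar>" for m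
      by (auto simp: indicator_def)
    show "AE x in lborel. (\<lambda>m. ?s m x) \<longlonglongrightarrow> 0"
    proof (rule AE_I2)
      fix x :: real
      show "(\<lambda>m. ?s m x) \<longlonglongrightarrow> 0"
      proof (cases "0 < x")
        case True
        have "(\<lambda>m. 1 / real (Suc m)) \<longlonglongrightarrow> 0" using LIMSEQ_inverse_real_of_nat by (simp add: inverse_eq_divide)
        then have "eventually (\<lambda>m. 1 / real (Suc m) < x) sequentially" using True by (rule order_tendstoD(2))
        then have "eventually (\<lambda>m. ?s m x = 0) sequentially" by eventually_elim (simp add: indicator_def)
        then show ?thesis by (rule tendsto_eventually)
      qed simp
    qed
  qed simp
  then show ?thesis by (simp add: set_lebesgue_integral_def)
qed

section \<open>Consistency\<close>

text \<open>
  The sample is a fixed sequence here, and randomness enters only through the four limits, which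
  concern countably many functions that do not depend on \<open>n\<close>; this is why cells have rational end
  points. The cut-off \<open>d\<close> near zero, the length \<open>L\<close> of the grid and the number \<open>N\<close> of its cells
  are chosen in this order, and only then is \<open>n\<close> taken large.
\<close>

theorem lse_L2_consistent:
  fixes xs :: "nat \<Rightarrow> real" and g :: "nat \<Rightarrow> real \<Rightarrow> real"
  assumes g0: "k_monotone k g0" "square_integrable g0" and int0: "set_integrable lborel {0<..} g0"
    and int_inv: "set_integrable lborel {0<..} (\<lambda>x. x powr (- 1 / 2) * g0 x)"
    and xs: "\<And>i. 1 \<le> i \<Longrightarrow> 0 < xs i"
    and lse: "\<And>n. 1 \<le> n \<Longrightarrow> is_lse k n xs (g n)"
    and conv_inv: "(\<lambda>n. emp_mean n xs (\<lambda>x. x powr (- 1 / 2))) \<longlonglongrightarrow> a"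
    and conv_trunc: "\<And>m. (\<lambda>n. emp_mean n xs (\<lambda>x. x powr (- 1 / 2) * indicator {..1 / real (Suc m)} x))
      \<longlonglongrightarrow> (LBINT x:{0<..}. indicator {..1 / real (Suc m)} x * (x powr (- 1 / 2) * g0 x))"
    and conv_cell: "\<And>s t. s \<in> \<rat> \<Longrightarrow> t \<in> \<rat> \<Longrightarrow>
      (\<lambda>n. emp_mean n xs (indicator {s<..t})) \<longlonglongrightarrow> cell_mass g0 s t"
    and conv_g0: "(\<lambda>n. emp_mean n xs g0) \<longlonglongrightarrow> inner_L2 g0 g0"
  shows "(\<lambda>n. LBINT x:{0<..}. (g n x - g0 x)\<^sup>2) \<longlonglongrightarrow> 0"
proof (rule order_tendstoI)
  fix b :: real assume "b < 0"
  moreover have "0 \<le> (LBINT x:{0<..}. (g n x - g0 x)\<^sup>2)" for n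
    by (simp add: set_lebesgue_integral_def)
  ultimately show "eventually (\<lambda>n. b < (LBINT x:{0<..}. (g n x - g0 x)\<^sup>2)) sequentially"
    by (intro always_eventually allI) (rule less_le_trans)
next
  fix b :: real assume "0 < b"
  \<comment> \<open>Five errors below \<open>e\<close> are added up in the end.\<close>
  define e where "e = b / 6"
  have e: "0 < e" using \<open>0 < b\<close> by (simp add: e_def)
  have "0 \<le> a" by (rule LIMSEQ_le_const[OF conv_inv]) (auto simp: emp_mean_def sum_nonneg)
  define C where "C = a + 1"
  have C: "0 < C" "a < C" using \<open>0 \<le> a\<close> by (auto simp: C_def)
  define \<Psi> where "\<Psi> m = (LBINT x:{0<..}. indicator {..1 / real (Suc m)} x * (x powr (- 1 / 2) * g0 x))" for m
  have "(\<lambda>m. C * \<Psi> m) \<longlonglongrightarrow> C * 0"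
    unfolding \<Psi>_def by (intro tendsto_mult_left truncated_moment_tendsto_0 int_inv)
  then have "eventually (\<lambda>m. C * \<Psi> m < e) sequentially" using e by (intro order_tendstoD(2)) auto
  then obtain m where m: "C * \<Psi> m < e" using eventually_happens'[OF sequentially_bot] by blast
  define d where "d = 1 / real (Suc m)"
  have d: "0 < d" "d \<in> \<rat>" by (auto simp: d_def)
  obtain L :: nat where L: "(C / e)\<^sup>2 < real L" using reals_Archimedean2 by blast
  have L0: "0 < real L" using L by (meson le_less_trans zero_le_power2)
  have "C / e < sqrt (d + real L)" using L d by (intro real_less_rsqrt) simp
  then have tail: "C / sqrt (d + real L) < e" using C e d L0 by (simp add: field_simps add_pos_pos)
  obtain N :: nat where N: "C / sqrt d * g0 d * real L / e < real N" using reals_Archimedean2 by blast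
  have "0 \<le> C / sqrt d * g0 d * real L / e" using C d e k_monotone_fun_nonneg[OF g0(1) d(1)] by simp
  then have N0: "0 < real N" using N by linarith
  define h where "h = real L / real N"
  have h: "0 < h" "h \<in> \<rat>" "real N * h = real L" using L0 N0 by (auto simp: h_def)
  have mesh: "C / sqrt d * (g0 d * h) < e" 
  proof -
    have "C / sqrt d * g0 d * real L < real N * e" using N e by (simp only: pos_divide_less_eq)
    moreover have "C / sqrt d * (g0 d * h) = C / sqrt d * g0 d * real L / real N" by (simp add: h_def)
    ultimately show ?thesis using N0 by (simp only: pos_divide_less_eq mult.commute)
  qed
  define t where "t j = d + real j * h" for j
  have tQ: "t j \<in> \<rat>" for j using d h by (auto simp: t_def)
  let ?S = "\<lambda>n. \<Sum>j<N. \<bar>emp_mean n xs (indicator {t j<..t (Suc j)}) - cell_mass g0 (t j) (t (Suc j))\<bar>"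
  have "(\<lambda>n. C / sqrt d * ?S n) \<longlonglongrightarrow> C / sqrt d * (\<Sum>j<N. \<bar>cell_mass g0 (t j) (t (Suc j)) - cell_mass g0 (t j) (t (Suc j))\<bar>)"
    by (intro tendsto_mult_left tendsto_sum tendsto_rabs tendsto_diff tendsto_const conv_cell tQ)
  then have cells: "eventually (\<lambda>n. C / sqrt d * ?S n < e) sequentially"
    using e by (intro order_tendstoD(2)) auto
  have "(\<lambda>n. C * emp_mean n xs (\<lambda>x. x powr (- 1 / 2) * indicator {..d} x)) \<longlonglongrightarrow> C * \<Psi> m"
    unfolding \<Psi>_def d_def by (intro tendsto_mult_left conv_trunc)
  then have trunc: "eventually (\<lambda>n. C * emp_mean n xs (\<lambda>x. x powr (- 1 / 2) * indicator {..d} x) < e) sequentially"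
    using m by (rule order_tendstoD(2))
  have inv: "eventually (\<lambda>n. emp_mean n xs (\<lambda>x. x powr (- 1 / 2)) < C) sequentially"
    using C by (intro order_tendstoD(2)[OF conv_inv])
  have g0ev: "eventually (\<lambda>n. inner_L2 g0 g0 - e < emp_mean n xs g0) sequentially"
    using e by (intro order_tendstoD(1)[OF conv_g0]) auto
  show "eventually (\<lambda>n. (LBINT x:{0<..}. (g n x - g0 x)\<^sup>2) < b) sequentially"
    using cells trunc inv g0ev eventually_ge_at_top[of 1]
  proof eventually_elim
    case (elim n)
    have l: "is_lse k n xs (g n)" using lse elim by simp
    then have gn: "k_monotone k (g n)" "square_integrable (g n)" by (auto simp: is_lse_def)
    have "sqrt (inner_L2 (g n) (g n)) \<le> C" using lse_norm_bound[OF l xs] elim(3) by linarith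
    then have bound: "g n x \<le> C * x powr (- 1 / 2)" if "0 < x" for x
      using k_monotone_L2_pointwise_bound[OF gn that] by (meson mult_right_mono order_trans powr_ge_zero)
    have "emp_mean n xs (g n) - inner_L2 (g n) g0
        \<le> C * emp_mean n xs (\<lambda>x. x powr (- 1 / 2) * indicator {..d} x) + C / sqrt (t N)
          + C / sqrt d * ?S n + C / sqrt d * (g0 d * h)"
      unfolding t_def
      by (rule bracketing_bound[OF gn(1) bound _ g0(1) int0 square_integrable_mult[OF gn(2) g0(2)] xs])
        (use C elim(5) d h in auto)
    moreover have "t N = d + real L" using h by (simp add: t_def)
    ultimately have "emp_mean n xs (g n) - inner_L2 (g n) g0 < e + e + e + e"
      using elim tail mesh by simp
    moreover have "inner_L2 g0 g0 - emp_mean n xs g0 < e" using elim by linarith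
    ultimately have "(LBINT x:{0<..}. (g n x - g0 x)\<^sup>2) < e + e + e + e + e"
      using lse_L2_error_bound[OF l g0] by linarith
    then show ?case using e by (simp add: e_def)
  qed
qed

lemma indicator_mult_measurable:
  assumes "k_monotone k g"
  shows "(\<lambda>x. indicator {0<..} x * g x) \<in> borel_measurable borel"
  using borel_measurable_continuous_on_indicator[OF _ k_monotone_fun_continuous[OF assms]] by simp

lemma halfline_density_eq: "halfline_density g x = ennreal (indicator {0<..} x * g x)"
  by (simp add: halfline_density_def indicator_def)

lemma
  fixes f :: "real \<Rightarrow> real"
  assumes g: "k_monotone k g" and f: "f \<in> borel_measurable borel"
  shows integrable_law: "integrable (law g) f \<longleftrightarrow> set_integrable lborel {0<..} (\<lambda>x. f x * g x)"
    and integral_law: "integral\<^sup>L (law g) f = (LBINT x:{0<..}. f x * g x)"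
proof -
  let ?d = "\<lambda>x. indicator {0<..} x * g x"
  have D: "law g = density lborel (\<lambda>x. ennreal (?d x))"
    by (simp add: law_def halfline_density_eq[abs_def])
  have d: "?d \<in> borel_measurable lborel" "AE x in lborel. 0 \<le> ?d x"
    using indicator_mult_measurable[OF g] k_monotone_fun_nonneg[OF g] by (auto simp: indicator_def)
  have f': "f \<in> borel_measurable lborel" using f by simp
  have eq: "(\<lambda>x. ?d x *\<^sub>R f x) = (\<lambda>x. indicator {0<..} x *\<^sub>R (f x * g x))"
    by (auto simp: indicator_def)
  show "integrable (law g) f \<longleftrightarrow> set_integrable lborel {0<..} (\<lambda>x. f x * g x)"
    unfolding D integrable_density[OF f' d] eq set_integrable_def ..
  show "integral\<^sup>L (law g) f = (LBINT x:{0<..}. f x * g x)"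
    unfolding D integral_density[OF f' d] eq set_lebesgue_integral_def ..
qed

text \<open>
  The moment condition alone gives \<open>g x \<le> I * x powr (- 1 / 2)\<close>, where \<open>I\<close> is the moment: on
  \<open>(0, x]\<close> both factors of its integrand are at least their values at \<open>x\<close>. One factor of \<open>g\<^sup>2\<close> is
  then estimated by this bound.
\<close>

lemma square_integrable_if_inverse_sqrt_moment:
  assumes g: "k_monotone k g" and int: "set_integrable lborel {0<..} (\<lambda>x. x powr (- 1 / 2) * g x)"
  shows "square_integrable g"
  unfolding square_integrable_def
proof
  let ?I = "LBINT x:{0<..}. x powr (- 1 / 2) * g x"
  have nn: "0 \<le> g x" if "0 < x" for x using k_monotone_fun_nonneg[OF g that] .
  have bound: "g x \<le> ?I * x powr (- 1 / 2)" if x: "0 < x" for x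
  proof -
    have "(x powr (- 1 / 2) * g x) * (x - 0) \<le> ?I"
    proof (rule set_integral_ge_const[OF int])
      fix y assume y: "0 < y" "y \<le> x"
      have "x powr (- 1 / 2) \<le> y powr (- 1 / 2)"
        using y x by (intro powr_mono2') auto
      then show "x powr (- 1 / 2) * g x \<le> y powr (- 1 / 2) * g y"
        using k_monotone_fun_antimono[OF g y] nn[OF x] by (intro mult_mono) auto
    qed (use x nn in auto)
    moreover have pw: "x powr (- 1 / 2) * x = sqrt x"
      using x by (simp add: powr_minus_half real_div_sqrt del: divide_minus_left)
    have "g x * sqrt x = (x powr (- 1 / 2) * g x) * (x - 0)"
      unfolding pw[symmetric] by (simp only: mult_ac diff_zero)
    ultimately have "g x * sqrt x \<le> ?I" by (simp only:)
    then show ?thesis unfolding powr_minus_half[OF x] using x by (simp add: pos_le_divide_eq)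
  qed
  show m: "set_borel_measurable lborel {0<..} g"
    using indicator_mult_measurable[OF g] by (simp add: set_borel_measurable_def)
  show "set_integrable lborel {0<..} (\<lambda>x. (g x)\<^sup>2)"
  proof (rule set_integrable_bound)
    show "set_integrable lborel {0<..} (\<lambda>x. ?I * (x powr (- 1 / 2) * g x))" using int by simp
    have "(\<lambda>x. (indicator {0<..} x * g x)\<^sup>2) \<in> borel_measurable borel"
      using indicator_mult_measurable[OF g] by (rule borel_measurable_power)
    moreover have "(\<lambda>x. (indicator {0<..} x * g x)\<^sup>2) = (\<lambda>x. indicator {0<..} x *\<^sub>R (g x)\<^sup>2)"
      by (auto simp: indicator_def)
    ultimately show "set_borel_measurable lborel {0<..} (\<lambda>x. (g x)\<^sup>2)"
      by (simp add: set_borel_measurable_def)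
    show "AE x in lborel. x \<in> {0<..} \<longrightarrow> norm ((g x)\<^sup>2) \<le> norm (?I * (x powr (- 1 / 2) * g x))"
    proof (intro AE_I2 impI)
      fix x :: real assume "x \<in> {0<..}"
      then have x: "0 < x" by simp
      have "g x * g x \<le> (?I * x powr (- 1 / 2)) * g x" by (intro mult_right_mono bound nn x)
      then show "norm ((g x)\<^sup>2) \<le> norm (?I * (x powr (- 1 / 2) * g x))"
        using abs_ge_self[of "?I * (x powr (- 1 / 2) * g x)"]
        unfolding real_norm_def power2_eq_square abs_of_nonneg[OF mult_nonneg_nonneg[OF nn[OF x] nn[OF x]]]
        by (simp only: mult.assoc)
    qed
  qed
qed

lemma iid_sample_law:
  assumes M: "prob_space M" and ind: "prob_space.indep_vars M (\<lambda>_. borel) X {1..}"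
    and X: "\<And>i. 1 \<le> i \<Longrightarrow> distributed M lborel (X i) (halfline_density g0)"
  shows "iid_sample M X (law g0)"
proof -
  interpret prob_space M by (rule M)
  show ?thesis
  proof unfold_locales
    show "indep_vars (\<lambda>_. borel) X {1..}" by (rule ind)
    fix i :: nat assume "1 \<le> i"
    have "distr M borel (X i) = distr M lborel (X i)" by (intro distr_cong) auto
    then show "distr M borel (X i) = law g0"
      using distributed_distr_eq_density[OF X[OF \<open>1 \<le> i\<close>]] by (simp add: law_def)
  qed
qed

lemma (in iid_sample) AE_sample_positive:
  assumes D: "D = law g0" and g0: "k_monotone k g0"
  shows "AE \<omega> in M. \<forall>i\<ge>1. 0 < X i \<omega>"
proof -
  have "(\<lambda>x. ennreal (indicator {0<..} x * g0 x)) \<in> borel_measurable lborel"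
    using indicator_mult_measurable[OF g0] by simp
  then have "AE x in D. 0 < x"
    unfolding D law_def halfline_density_eq[abs_def] by (subst AE_density) (auto simp: indicator_def)
  then have "AE \<omega> in M. 0 < X i \<omega>" if "1 \<le> i" for i
    using that unfolding law_X[OF that, symmetric] by (subst (asm) AE_distr_iff) auto
  then show ?thesis by (subst AE_all_countable) auto
qed

text \<open>
  One event of probability one serves all points \<open>x\<close> and all the later limits. The index is
  shifted because the estimator is defined from sample size one on.
\<close>

theorem lse_pointwise_consistent:
  fixes X :: "nat \<Rightarrow> 'w \<Rightarrow> real" and gt :: "nat \<Rightarrow> 'w \<Rightarrow> real \<Rightarrow> real"
  assumes g0d: "k_monotone_density k g0"
    and mom: "(\<integral>\<^sup>+x. ennreal (x powr (- 1 / 2)) \<partial>law g0) < \<infinity>"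
    and M: "prob_space M" and ind: "prob_space.indep_vars M (\<lambda>_. borel) X {1..}"
    and X: "\<And>i. 1 \<le> i \<Longrightarrow> distributed M lborel (X i) (halfline_density g0)"
    and lse: "AE \<omega> in M. \<forall>n\<ge>1. is_lse k n (\<lambda>i. X i \<omega>) (gt n \<omega>)"
  shows "AE \<omega> in M. (\<forall>n. k_monotone k (gt (Suc n) \<omega>)) \<and>
    (\<forall>x>0. (\<lambda>n. gt (Suc n) \<omega> x) \<longlonglongrightarrow> g0 x)"
proof -
  have g0: "k_monotone k g0" using g0d by (simp add: k_monotone_density_def)
  interpret iid_sample M X "law g0" by (rule iid_sample_law[OF M ind X])
  interpret D: prob_space "law g0" by (rule prob_space_D)
  let ?\<phi> = "\<lambda>x::real. x powr (- 1 / 2)"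
  have "integrable (law g0) ?\<phi>"
    using mom by (intro integrableI_nonneg) auto
  then have int_inv: "set_integrable lborel {0<..} (\<lambda>x. ?\<phi> x * g0 x)"
    using integrable_law[OF g0, of ?\<phi>] by simp
  have int0: "set_integrable lborel {0<..} g0"
    using integrable_law[OF g0, of "\<lambda>_. 1"] by simp
  have sq: "square_integrable g0" by (rule square_integrable_if_inverse_sqrt_moment[OF g0 int_inv])
  have slln: "AE \<omega> in M. (\<lambda>n. emp_mean n (\<lambda>i. X i \<omega>) f) \<longlonglongrightarrow> (LBINT x:{0<..}. f x * g0 x)"
    if "f \<in> borel_measurable borel" "\<And>x. 0 \<le> f x" "set_integrable lborel {0<..} (\<lambda>x. f x * g0 x)" for f
    using strong_law_nonneg[of f] that integrable_law[OF g0 that(1)] integral_law[OF g0 that(1)] by simp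
  have "AE \<omega> in M. (\<lambda>n. emp_mean n (\<lambda>i. X i \<omega>) ?\<phi>) \<longlonglongrightarrow> (LBINT x:{0<..}. ?\<phi> x * g0 x)"
    by (rule slln) (use int_inv in auto)
  moreover have "AE \<omega> in M. (\<lambda>n. emp_mean n (\<lambda>i. X i \<omega>) (\<lambda>x. ?\<phi> x * indicator {..1 / real (Suc m)} x))
      \<longlonglongrightarrow> (LBINT x:{0<..}. indicator {..1 / real (Suc m)} x * (?\<phi> x * g0 x))" for m
  proof -
    have eq: "(\<lambda>x. (?\<phi> x * indicator {..1 / real (Suc m)} x) * g0 x)
        = (\<lambda>x. indicator {..1 / real (Suc m)} x * (?\<phi> x * g0 x))" by (simp add: mult_ac)
    have "(\<lambda>x. ?\<phi> x * indicator {..1 / real (Suc m)} x) \<in> borel_measurable borel" by measurable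
    from slln[OF this, unfolded eq] show ?thesis
      using set_integrable_indicator_mult[OF int_inv, of "{..1 / real (Suc m)}"] by simp
  qed
  then have "AE \<omega> in M. \<forall>m. (\<lambda>n. emp_mean n (\<lambda>i. X i \<omega>) (\<lambda>x. ?\<phi> x * indicator {..1 / real (Suc m)} x))
      \<longlonglongrightarrow> (LBINT x:{0<..}. indicator {..1 / real (Suc m)} x * (?\<phi> x * g0 x))"
    by (simp only: AE_all_countable simp_thms)
  moreover have "AE \<omega> in M. (\<lambda>n. emp_mean n (\<lambda>i. X i \<omega>) (indicator {s<..t})) \<longlonglongrightarrow> cell_mass g0 s t" for s t
    unfolding cell_mass_def
    by (rule slln) (use set_integrable_indicator_mult[OF int0, of "{s<..t}"] in auto)
  then have "AE \<omega> in M. \<forall>s\<in>\<rat>. \<forall>t\<in>\<rat>.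
      (\<lambda>n. emp_mean n (\<lambda>i. X i \<omega>) (indicator {s<..t})) \<longlonglongrightarrow> cell_mass g0 s t"
    by (simp add: AE_ball_countable countable_rat)
  moreover have "AE \<omega> in M. (\<lambda>n. emp_mean n (\<lambda>i. X i \<omega>) (\<lambda>x. indicator {0<..} x * g0 x)) \<longlonglongrightarrow> inner_L2 g0 g0"
  proof -
    have int: "set_integrable lborel {0<..} (\<lambda>x. indicator {0<..} x * (g0 x * g0 x))"
      by (rule set_integrable_indicator_mult[OF square_integrable_mult[OF sq sq]]) simp
    have "AE \<omega> in M. (\<lambda>n. emp_mean n (\<lambda>i. X i \<omega>) (\<lambda>x. indicator {0<..} x * g0 x))
        \<longlonglongrightarrow> (LBINT x:{0<..}. (indicator {0<..} x * g0 x) * g0 x)"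
      by (rule slln[OF indicator_mult_measurable[OF g0]])
        (use int k_monotone_fun_nonneg[OF g0] in \<open>auto simp: indicator_def mult.assoc\<close>)
    moreover have "(LBINT x:{0<..}. (indicator {0<..} x * g0 x) * g0 x) = inner_L2 g0 g0"
      unfolding inner_L2_def by (intro set_lebesgue_integral_cong) auto
    ultimately show ?thesis by simp
  qed
  moreover note AE_sample_positive[OF refl g0] lse
  ultimately show ?thesis
  proof eventually_elim
    case (elim \<omega>)
    have l: "is_lse k n (\<lambda>i. X i \<omega>) (gt n \<omega>)" if "1 \<le> n" for n using elim(6) that by blast
    have km: "k_monotone k (gt (Suc n) \<omega>)" "square_integrable (gt (Suc n) \<omega>)" for n
      using l[of "Suc n"] by (auto simp: is_lse_def)
    have emp: "emp_mean n (\<lambda>i. X i \<omega>) (\<lambda>x. indicator {0<..} x * g0 x) = emp_mean n (\<lambda>i. X i \<omega>) g0" for n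
      unfolding emp_mean_def using elim(5) by (intro arg_cong2[where f = "(/)"] sum.cong) auto
    have "(\<lambda>n. LBINT x:{0<..}. (gt n \<omega> x - g0 x)\<^sup>2) \<longlonglongrightarrow> 0"
    proof (rule lse_L2_consistent[OF g0 sq int0 int_inv])
      show "0 < X i \<omega>" if "1 \<le> i" for i using elim(5) that by blast
      show "(\<lambda>n. emp_mean n (\<lambda>i. X i \<omega>) g0) \<longlonglongrightarrow> inner_L2 g0 g0" using elim(4) by (simp only: emp)
    qed (use elim(1-3) l in blast)+
    then have L2: "(\<lambda>n. LBINT x:{0<..}. (gt (Suc n) \<omega> x - g0 x)\<^sup>2) \<longlonglongrightarrow> 0" by (rule LIMSEQ_Suc)
    have "(\<lambda>n. gt (Suc n) \<omega> x) \<longlonglongrightarrow> g0 x" if "0 < x" for x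
    proof (rule antimono_L2_tendsto_pointwise[OF _ k_monotone_fun_continuous[OF g0] _ L2 that])
      show "gt (Suc n) \<omega> z \<le> gt (Suc n) \<omega> y" if "0 < y" "y \<le> z" for n y z
        by (rule k_monotone_fun_antimono[OF km(1) that])
      show "set_integrable lborel {0<..} (\<lambda>x. (gt (Suc n) \<omega> x - g0 x)\<^sup>2)" for n
        using square_integrable_lincomb[OF km(2) sq, of 1 n "-1"] by (simp add: square_integrable_def)
    qed
    then show ?case using km by blast
  qed
qed

theorem corollary3p2:
  fixes k :: nat and g0 :: "real \<Rightarrow> real" and c :: real
    and M :: "'w measure" and X :: "nat \<Rightarrow> 'w \<Rightarrow> real"
    and gt :: "nat \<Rightarrow> 'w \<Rightarrow> real \<Rightarrow> real"
  assumes "2 \<le> k"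
    and "k_monotone_density k g0"
    and "(\<integral>\<^sup>+x. ennreal (x powr (- 1 / 2)) \<partial>law g0) < \<infinity>"
    and "prob_space M"
    and "prob_space.indep_vars M (\<lambda>_. borel) X {1..}"
    and "\<And>i. 1 \<le> i \<Longrightarrow> distributed M lborel (X i) (halfline_density g0)"
    and "AE \<omega> in M. \<forall>n\<ge>1. is_lse k n (\<lambda>i. X i \<omega>) (gt n \<omega>)"
    and "0 < c"
  shows "(\<forall>j\<in>{1..k - 2}. AE \<omega> in M.
            (\<lambda>n. SUP x\<in>{c..}. ereal \<bar>(deriv ^^ j) (gt n \<omega>) x - (deriv ^^ j) g0 x\<bar>)
              \<longlonglongrightarrow> 0) \<and>
         (\<forall>x>0. (deriv ^^ (k - 2)) g0 differentiable (at x) \<longrightarrow>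
            (AE \<omega> in M. (\<lambda>n. left_top_deriv k (gt n \<omega>) x)
                \<longlonglongrightarrow> (deriv ^^ (k - 1)) g0 x) \<and>
            (AE \<omega> in M. (\<lambda>n. right_top_deriv k (gt n \<omega>) x)
                \<longlonglongrightarrow> (deriv ^^ (k - 1)) g0 x))"
proof -
  have g0: "k_monotone k g0" using assms(2) by (simp add: k_monotone_density_def)
  have pointwise: "AE \<omega> in M. (\<forall>n. k_monotone k (gt (Suc n) \<omega>)) \<and>
      (\<forall>x>0. (\<lambda>n. gt (Suc n) \<omega> x) \<longlonglongrightarrow> g0 x)"
    by (rule lse_pointwise_consistent[OF assms(2-5) _ assms(7)]) (rule assms(6))
  have "AE \<omega> in M. (\<lambda>n. SUP x\<in>{c..}. ereal \<bar>(deriv ^^ j) (gt n \<omega>) x - (deriv ^^ j) g0 x\<bar>) \<longlonglongrightarrow> 0"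
    if "j \<in> {1..k - 2}" for j
    using pointwise
  proof eventually_elim
    case (elim \<omega>)
    show ?case
      by (rule LIMSEQ_imp_Suc, rule k_monotone_derivs_uniform) (use elim g0 assms(8) that in auto)
  qed
  moreover have "(AE \<omega> in M. (\<lambda>n. left_top_deriv k (gt n \<omega>) x) \<longlonglongrightarrow> (deriv ^^ (k - 1)) g0 x) \<and>
      (AE \<omega> in M. (\<lambda>n. right_top_deriv k (gt n \<omega>) x) \<longlonglongrightarrow> (deriv ^^ (k - 1)) g0 x)"
    if "0 < x" "(deriv ^^ (k - 2)) g0 differentiable (at x)" for x
  proof
    show "AE \<omega> in M. (\<lambda>n. left_top_deriv k (gt n \<omega>) x) \<longlonglongrightarrow> (deriv ^^ (k - 1)) g0 x"
      using pointwise
    proof eventually_elim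
      case (elim \<omega>)
      show ?case
        by (rule LIMSEQ_imp_Suc, rule k_monotone_top_deriv_tendsto(1)[OF assms(1) _ g0 _ that]) (use elim in auto)
    qed
    show "AE \<omega> in M. (\<lambda>n. right_top_deriv k (gt n \<omega>) x) \<longlonglongrightarrow> (deriv ^^ (k - 1)) g0 x"
      using pointwise
    proof eventually_elim
      case (elim \<omega>)
      show ?case
        by (rule LIMSEQ_imp_Suc, rule k_monotone_top_deriv_tendsto(2)[OF assms(1) _ g0 _ that]) (use elim in auto)
    qed
  qed
  ultimately show ?thesis by blast
qed

end
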